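(* Let $m\in\mathbb{N}$, let $f(z)=\sum_{n=0}^{\infty}a_nz^n\in\mathcal{B}$, $a:=|a_0|$, and let $\omega\in\mathcal{B}_m$. Then $$G_f(z):=|f(\omega(z))|+|z|\,|f'(\omega(z))|+B_2(f,r)+\frac{1+ar}{(1+a)(1-r)}\|f_0\|_r^2\le 1$$ for all $z$ with $|z|=r\in[0,\theta_m]$, where $\theta_m$ is the unique root in $(0,1)$ of the equation $$2r^{2m+2}-r^{2m+1}+r^{2m}+4r^{m+2}+3r-1=0.$$ The upper bound $\theta_m$ cannot be improved. Moreover, $$H_f(z):=|f(\omega(z))|^2+|z|\,|f'(\omega(z))|+B_2(f,r)+\frac{1+ar}{(1+a)(1-r)}\|f_0\|_r^2\le 1$$ for all $z$ with $|z|=r\in[0,\vartheta_m]$, where $\vartheta_m$ is the unique root in $(0,1)$ of the equation $$r^{2m+2}-r^{2m+1}+r^{2m}+2r^{m+2}+2r-1=0.$$ The upper bound $\vartheta_m$ cannot be improved.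
   Context: $\mathbb{D}=\{z\in\mathbb{C}:|z|<1\}$ and $\mathbb{N}=\{1,2,\dots\}$. $\mathcal{B}$ is the class of analytic functions $f$ on $\mathbb{D}$ with $\sup_{z\in\mathbb{D}}|f(z)|\le 1$. For $m\in\mathbb{N}$, $\mathcal{B}_m$ is the set of $\omega\in\mathcal{B}$ with $\omega(0)=\omega'(0)=\cdots=\omega^{(m-1)}(0)=0$ and $\omega^{(m)}(0)\ne 0$. For $f(z)=\sum_{n\ge 0}a_nz^n\in\mathcal{B}$ put $f_0(z)=f(z)-f(0)$, $B_k(f,r)=\sum_{n=k}^{\infty}|a_n|r^n$ for $k\ge 0$, and $\|f_0\|_r^2=\sum_{n=1}^{\infty}|a_n|^2r^{2n}$. $f'(\omega(z))$ is the derivative of $f$ evaluated at the point $\omega(z)$. Throughout $r=|z|<1$. Saying that a constant $\rho$ (for given $m$) cannot be improved means that there is no $\rho'\in(\rho,1)$ such that the corresponding inequality holds for all $f\in\mathcal{B}$, all $\omega\in\mathcal{B}_m$ and all $z$ with $|z|\le\rho'$. *)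

theory Defs
  imports "HOL-Complex_Analysis.Complex_Analysis"
begin

definition unit_bounded :: "(complex \<Rightarrow> complex) set" where
  "unit_bounded = {f. f analytic_on ball 0 1 \<and> (\<forall>z\<in>ball 0 1. cmod (f z) \<le> 1)}"

definition unit_bounded_ord :: "nat \<Rightarrow> (complex \<Rightarrow> complex) set" where
  "unit_bounded_ord m =
     {\<omega> \<in> unit_bounded. (\<forall>k<m. (deriv ^^ k) \<omega> 0 = 0) \<and> (deriv ^^ m) \<omega> 0 \<noteq> 0}"

definition tcoeff :: "(complex \<Rightarrow> complex) \<Rightarrow> nat \<Rightarrow> complex" where
  "tcoeff f n = fps_nth (fps_expansion f 0) n"

definition majorant_tail :: "nat \<Rightarrow> (complex \<Rightarrow> complex) \<Rightarrow> real \<Rightarrow> real" where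
  "majorant_tail k f r = (\<Sum>n. cmod (tcoeff f (n + k)) * r ^ (n + k))"

text \<open>The squared norm of \<open>f\<^sub>0(z) = f(z) - f(0)\<close>, so the summation starts at index 1.\<close>

definition sqnorm0 :: "(complex \<Rightarrow> complex) \<Rightarrow> real \<Rightarrow> real" where
  "sqnorm0 f r = (\<Sum>n. (cmod (tcoeff f (n + 1)))\<^sup>2 * r ^ (2 * (n + 1)))"

definition G_fun :: "(complex \<Rightarrow> complex) \<Rightarrow> (complex \<Rightarrow> complex) \<Rightarrow> complex \<Rightarrow> real" where
  "G_fun f \<omega> z = (let r = cmod z; a = cmod (tcoeff f 0) in
     cmod (f (\<omega> z)) + cmod z * cmod (deriv f (\<omega> z)) + majorant_tail 2 f r
       + (1 + a * r) / ((1 + a) * (1 - r)) * sqnorm0 f r)"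

definition H_fun :: "(complex \<Rightarrow> complex) \<Rightarrow> (complex \<Rightarrow> complex) \<Rightarrow> complex \<Rightarrow> real" where
  "H_fun f \<omega> z = (let r = cmod z; a = cmod (tcoeff f 0) in
     (cmod (f (\<omega> z)))\<^sup>2 + cmod z * cmod (deriv f (\<omega> z)) + majorant_tail 2 f r
       + (1 + a * r) / ((1 + a) * (1 - r)) * sqnorm0 f r)"

definition theta_poly :: "nat \<Rightarrow> real \<Rightarrow> real" where
  "theta_poly m r =
     2 * r ^ (2 * m + 2) - r ^ (2 * m + 1) + r ^ (2 * m) + 4 * r ^ (m + 2) + 3 * r - 1"

definition vartheta_poly :: "nat \<Rightarrow> real \<Rightarrow> real" where
  "vartheta_poly m r =
     r ^ (2 * m + 2) - r ^ (2 * m + 1) + r ^ (2 * m) + 2 * r ^ (m + 2) + 2 * r - 1"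

text \<open>The infinite sums above are totalised by \<^const>\<open>suminf\<close>; the following facts show that they
  are genuine convergent series of the coefficients of \<open>f\<close> for radii below 1.\<close>

lemma tcoeff_sums:
  assumes "f \<in> unit_bounded" and "cmod z < 1"
  shows "(\<lambda>n. tcoeff f n * z ^ n) sums f z"
proof -
  have "f holomorphic_on ball 0 1"
    using assms(1) by (simp add: unit_bounded_def analytic_imp_holomorphic)
  from holomorphic_power_series[OF this, of z] assms(2) show ?thesis
    by (simp add: tcoeff_def fps_expansion_def)
qed

lemma summable_majorant:
  assumes "f \<in> unit_bounded" and "0 \<le> r" and "r < 1"
  shows "summable (\<lambda>n. cmod (tcoeff f (n + k)) * r ^ (n + k))"
proof -
  obtain s where s: "r < s" "s < 1"
    using assms(3) dense by blast
  have "summable (\<lambda>n. tcoeff f n * complex_of_real s ^ n)"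
    using tcoeff_sums[OF assms(1), of "complex_of_real s"] s assms(2)
    by (simp add: sums_iff)
  from powser_insidea[OF this, of "complex_of_real r"] s assms(2)
  have "summable (\<lambda>n. cmod (tcoeff f n) * r ^ n)"
    by (simp add: norm_mult norm_power)
  then show ?thesis
    by (subst summable_iff_shift)
qed

lemma summable_sqnorm0:
  assumes "f \<in> unit_bounded" and "0 \<le> r" and "r < 1"
  shows "summable (\<lambda>n. (cmod (tcoeff f (n + 1)))\<^sup>2 * r ^ (2 * (n + 1)))"
proof -
  let ?b = "\<lambda>n. cmod (tcoeff f (n + 1)) * r ^ (n + 1)"
  have sb: "summable ?b"
    using summable_majorant[OF assms] .
  have "eventually (\<lambda>n. norm (?b n) < 1) sequentially"
    using tendstoD[OF summable_LIMSEQ_zero[OF sb], of 1] by (simp add: dist_norm)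
  then have "eventually (\<lambda>n. norm ((?b n)\<^sup>2) \<le> ?b n) sequentially"
  proof eventually_elim
    case (elim n)
    then show ?case
      using assms(2) mult_left_le[of "?b n" "?b n"] by (simp add: power2_eq_square abs_mult)
  qed
  from summable_comparison_test_ev[OF this sb] have "summable (\<lambda>n. (?b n)\<^sup>2)" .
  moreover have "(?b n)\<^sup>2 = (cmod (tcoeff f (n + 1)))\<^sup>2 * r ^ (2 * (n + 1))" for n
    by (simp only: power_mult_distrib power_mult[symmetric] mult.commute[of 2])
  ultimately show ?thesis
    by (simp only:)
qed

end

theory Submission
  imports Defs
begin

text \<open>
  Put \<open>r = |z|\<close>, \<open>\<rho> = r\<^sup>m\<close> and \<open>u = |f(\<omega>(z))|\<close>. The last two summands of both functionals are
  controlled by the refined Bohr inequality \<open>refined_bohr\<close>: together they are at most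
  \<open>(1 - a\<^sup>2) r\<^sup>2 / (1 - r)\<close>. It comes from adding up Carlson's bounds for the coefficients,
  \<open>|a\<^bsub>2n+1\<^esub>| \<le> 1 - (|a\<^sub>0|\<^sup>2 + ... + |a\<^sub>n|\<^sup>2)\<close> and
  \<open>|a\<^bsub>2n\<^esub>| \<le> 1 - (|a\<^sub>0|\<^sup>2 + ... + |a\<^bsub>n-1\<^esub>|\<^sup>2) - |a\<^sub>n|\<^sup>2 / (1 + a)\<close>,
  and these in turn express that the lower triangular Toeplitz matrix of the coefficients
  of \<open>f\<close> is a contraction (\<open>toeplitz_contraction\<close>), tested on suitable vectors.

  The first two summands are controlled by the Schwarz and Schwarz--Pick inequalities: \<open>|\<omega>(z)| \<le> \<rho>\<close>,
  hence \<open>u \<le> v = (\<rho> + a) / (1 + a \<rho>)\<close> and \<open>|f'(\<omega>(z))| \<le> (1 - u\<^sup>2) / (1 - \<rho>\<^sup>2)\<close>. Up to the critical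
  radius the resulting bound increases with \<open>u\<close>, so \<open>u\<close> may be replaced by \<open>v\<close>. What remains to
  show is that an explicit function of \<open>a\<close>, here called the gap, is nonnegative. If the gap is
  nonnegative at \<open>a = 1\<close>, it is so on all of \<open>[0, 1]\<close>, and at \<open>a = 1\<close> it is, up to a positive
  factor, minus the polynomial that defines the radius.

  All the inequalities are equalities for \<open>f(z) = (z + a) / (1 + a z)\<close>, \<open>\<omega>(z) = z\<^sup>m\<close> and \<open>z = r\<close>.
  Beyond the critical radius the gap at \<open>a = 1\<close> is negative, hence by continuity it is negative
  for some \<open>a < 1\<close>, and for this \<open>a\<close> the functional exceeds \<open>1\<close>.
\<close>

section \<open>Coefficients of bounded analytic functions\<close>

lemma unit_bounded_iff:
  "f \<in> unit_bounded \<longleftrightarrow> f holomorphic_on ball 0 1 \<and> (\<forall>z\<in>ball 0 1. cmod (f z) \<le> 1)"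
  by (simp add: unit_bounded_def analytic_on_open)

lemma tcoeff_eq_deriv: "tcoeff f n = (deriv ^^ n) f 0 / fact n"
  by (simp add: tcoeff_def fps_expansion_def)

lemma has_fps_expansion_tcoeff:
  assumes "f has_fps_expansion F"
  shows "tcoeff f n = fps_nth F n"
  using fps_expansion_eqI[OF assms] by (simp add: tcoeff_def)

lemma tcoeff_mult_power:
  assumes "f holomorphic_on ball 0 1"
  shows "tcoeff (\<lambda>z. f z * z ^ k) j = (if k \<le> j then tcoeff f (j - k) else 0)"
proof -
  have "f analytic_on {0}"
    using assms by (meson analytic_on_analytic_at centre_in_ball open_ball zero_less_one
        analytic_at singletonD)
  then have "f has_fps_expansion fps_expansion f 0"
    by (rule analytic_at_imp_has_fps_expansion_0)
  then have "(\<lambda>z. f z * z ^ k) has_fps_expansion fps_expansion f 0 * fps_X ^ k"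
    by (intro fps_expansion_intros)
  from has_fps_expansion_tcoeff[OF this] show ?thesis
    by (simp add: fps_X_power_mult_right_nth tcoeff_def)
qed

text \<open>Fourier coefficients on the circle of radius \<open>s\<close>. Those of negative index vanish, which is
  what makes the Toeplitz matrix below triangular.\<close>
lemma has_integral_tcoeff_circle:
  assumes f: "f holomorphic_on ball 0 1" and s: "0 < s" "s < 1"
  defines "e \<equiv> \<lambda>t. exp (\<i> * of_real (2 * pi * t))"
  shows "((\<lambda>t. f (of_real s * e t) * e t ^ k * cnj (e t) ^ j) has_integral
           (if k \<le> j then of_real s ^ (j - k) * tcoeff f (j - k) else 0)) {0..1::real}"
proof -
  define g where "g = (\<lambda>z. f z * z ^ k)"
  have holg: "g holomorphic_on ball 0 1"
    unfolding g_def by (intro holomorphic_intros f)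
  have sub: "cball 0 s \<subseteq> ball (0::complex) 1" "ball 0 s \<subseteq> ball (0::complex) 1"
    using s by auto
  have e1: "e t * cnj (e t) = 1" for t
    by (simp add: e_def exp_cnj flip: exp_add)
  have enz: "e t \<noteq> 0" for t by (simp add: e_def)
  have inv: "1 / e t = cnj (e t)" for t
    using e1[of t] enz[of t] by (simp add: field_simps)
  have "((\<lambda>u. g u / (u - 0) ^ Suc j) has_contour_integral
          (2 * pi * \<i>) / fact j * (deriv ^^ j) g 0) (circlepath 0 s)"
    using s by (intro Cauchy_has_contour_integral_higher_derivative_circlepath
        holomorphic_on_imp_continuous_on holomorphic_on_subset[OF holg] sub) auto
  then have "((\<lambda>t. g (circlepath 0 s t) / circlepath 0 s t ^ Suc j
               * (2 * pi * \<i> * s * exp (2 * of_real pi * \<i> * t))) has_integral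
              (2 * pi * \<i>) * tcoeff g j) {0..1}"
    unfolding has_contour_integral_def
    by (rule has_integral_eq[rotated, THEN has_integral_eq_rhs])
      (simp_all add: tcoeff_eq_deriv vector_derivative_circlepath01)
  moreover have "circlepath 0 s t = of_real s * e t" for t
    by (simp add: circlepath e_def mult_ac)
  moreover have "exp (2 * of_real pi * \<i> * t) = e t" for t
    by (simp add: e_def mult_ac)
  ultimately have "((\<lambda>t. g (s * e t) / (s * e t) ^ Suc j * (2 * pi * \<i> * s * e t))
              has_integral (2 * pi * \<i>) * tcoeff g j) {0..1}"
    by simp
  from has_integral_mult_right[OF this, of "of_real s ^ j / (of_real s ^ k * (2 * pi * \<i>))"]
  have *: "((\<lambda>t. of_real s ^ j / (of_real s ^ k * (2 * pi * \<i>)) *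
           (g (s * e t) / (s * e t) ^ Suc j * (2 * pi * \<i> * s * e t))) has_integral
         of_real s ^ j / of_real s ^ k * tcoeff g j) {0..1}"
    using s by (simp add: field_simps)
  have "of_real s ^ j / (of_real s ^ k * (2 * pi * \<i>)) *
           (g (s * e t) / (s * e t) ^ Suc j * (2 * pi * \<i> * s * e t))
        = f (s * e t) * e t ^ k * cnj (e t) ^ j" for t
    unfolding inv[symmetric] using s enz[of t]
    by (simp add: g_def field_simps power_mult_distrib)
  moreover have "of_real s ^ j / of_real s ^ k * tcoeff g j
      = (if k \<le> j then of_real s ^ (j - k) * tcoeff f (j - k) else 0)"
    using s by (simp add: g_def tcoeff_mult_power[OF f] power_diff)
  ultimately show ?thesis
    using * by simp
qed

lemma norm_bilinear_nonneg:
  assumes "cmod w \<le> 1"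
  shows "0 \<le> (cmod x)\<^sup>2 + (cmod y)\<^sup>2 + 2 * Re (cnj y * w * x)"
proof -
  have "\<bar>Re (cnj y * w * x)\<bar> \<le> cmod (cnj y * w * x)" by (rule abs_Re_le_cmod)
  also have "\<dots> = cmod w * (cmod x * cmod y)" by (simp add: norm_mult)
  also have "\<dots> \<le> cmod x * cmod y"
    using assms by (simp add: mult_left_le_one_le)
  finally have "2 * Re (cnj y * w * x) \<ge> - 2 * (cmod x * cmod y)" by linarith
  moreover have "0 \<le> (cmod x - cmod y)\<^sup>2" by simp
  ultimately show ?thesis by (simp add: power2_diff)
qed

text \<open>For polynomials \<open>X\<close>, \<open>Y\<close> with coefficients \<open>x\<close>, \<open>y\<close> the pointwise inequality
  \<open>|X|\<^sup>2 + |Y|\<^sup>2 + 2 Re (cnj Y \<cdot> f \<cdot> X) \<ge> 0\<close>, in which \<open>f\<close> is evaluated on the circle of radius \<open>s\<close>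
  and \<open>X\<close>, \<open>Y\<close> on the unit circle, is averaged over the circle.\<close>
lemma toeplitz_contraction_aux:
  fixes x y :: "nat \<Rightarrow> complex"
  assumes f: "f \<in> unit_bounded" and s: "0 < s" "s < 1"
  shows "0 \<le> (\<Sum>k\<le>N. (cmod (x k))\<^sup>2) + (\<Sum>j\<le>N. (cmod (y j))\<^sup>2)
      + 2 * Re (\<Sum>j\<le>N. \<Sum>k\<le>N. cnj (y j) * x k *
                 (if k \<le> j then of_real s ^ (j - k) * tcoeff f (j - k) else 0))"
proof -
  define e :: "real \<Rightarrow> complex" where "e = (\<lambda>t. exp (\<i> * of_real (2 * pi * t)))"
  define X where "X = (\<lambda>t. \<Sum>k\<le>N. x k * e t ^ k)"
  define Y where "Y = (\<lambda>t. \<Sum>k\<le>N. y k * e t ^ k)"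
  have bil: "((\<lambda>t. cnj (\<Sum>j\<le>N. v j * e t ^ j) * g (of_real s * e t) * (\<Sum>k\<le>N. u k * e t ^ k))
      has_integral (\<Sum>j\<le>N. \<Sum>k\<le>N. cnj (v j) * u k *
         (if k \<le> j then of_real s ^ (j - k) * tcoeff g (j - k) else 0))) {0..1}"
    if g: "g holomorphic_on ball 0 1" for g and u v :: "nat \<Rightarrow> complex"
  proof -
    have "((\<lambda>t. \<Sum>j\<le>N. \<Sum>k\<le>N. cnj (v j) * u k * (g (of_real s * e t) * e t ^ k * cnj (e t) ^ j))
      has_integral (\<Sum>j\<le>N. \<Sum>k\<le>N. cnj (v j) * u k *
         (if k \<le> j then of_real s ^ (j - k) * tcoeff g (j - k) else 0))) {0..1}"
      unfolding e_def
      by (intro has_integral_sum has_integral_mult_right has_integral_tcoeff_circle g s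
          finite_atMost)
    moreover have "(\<Sum>j\<le>N. \<Sum>k\<le>N. cnj (v j) * u k * (g (of_real s * e t) * e t ^ k * cnj (e t) ^ j))
        = cnj (\<Sum>j\<le>N. v j * e t ^ j) * g (of_real s * e t) * (\<Sum>k\<le>N. u k * e t ^ k)" for t
      unfolding cnj_sum sum_distrib_left sum_distrib_right
      by (subst sum.swap) (simp add: mult_ac)
    ultimately show ?thesis by simp
  qed
  have one: "tcoeff (\<lambda>_. 1) n = (if n = 0 then 1 else 0)" for n
    using has_fps_expansion_tcoeff[of "\<lambda>_. 1" 1] by (simp add: fps_expansion_intros)
  have sq: "((\<lambda>t. of_real ((cmod (\<Sum>k\<le>N. u k * e t ^ k))\<^sup>2)) has_integral
        (complex_of_real (\<Sum>k\<le>N. (cmod (u k))\<^sup>2))) {0..1}" for u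
  proof -
    have "(\<Sum>j\<le>N. \<Sum>k\<le>N. cnj (u j) * u k *
         (if k \<le> j then of_real s ^ (j - k) * tcoeff (\<lambda>_. 1) (j - k) else 0))
       = (\<Sum>j\<le>N. \<Sum>k\<le>N. if k = j then cnj (u j) * u k else 0)"
      by (intro sum.cong) (auto simp: one)
    also have "\<dots> = complex_of_real (\<Sum>k\<le>N. (cmod (u k))\<^sup>2)"
      by (simp add: sum.delta' complex_norm_square mult.commute del: of_real_power)
    finally have eq: "(\<Sum>j\<le>N. \<Sum>k\<le>N. cnj (u j) * u k *
         (if k \<le> j then of_real s ^ (j - k) * tcoeff (\<lambda>_. 1) (j - k) else 0))
         = complex_of_real (\<Sum>k\<le>N. (cmod (u k))\<^sup>2)" .
    show ?thesis
      using bil[of "\<lambda>_. 1" u u]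
      unfolding eq by (simp add: complex_norm_square mult.commute del: of_real_power of_real_sum)
  qed
  have "((\<lambda>t. of_real ((cmod (X t))\<^sup>2) + of_real ((cmod (Y t))\<^sup>2)
          + 2 * (cnj (Y t) * f (of_real s * e t) * X t)) has_integral
       (complex_of_real (\<Sum>k\<le>N. (cmod (x k))\<^sup>2) + complex_of_real (\<Sum>k\<le>N. (cmod (y k))\<^sup>2)
        + 2 * (\<Sum>j\<le>N. \<Sum>k\<le>N. cnj (y j) * x k *
                 (if k \<le> j then of_real s ^ (j - k) * tcoeff f (j - k) else 0)))) {0..1}"
    unfolding X_def Y_def
    using f by (intro has_integral_add has_integral_mult_right sq bil) (simp add: unit_bounded_iff)
  from has_integral_linear[OF this bounded_linear_Re]
  have "((\<lambda>t. (cmod (X t))\<^sup>2 + (cmod (Y t))\<^sup>2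
          + 2 * Re (cnj (Y t) * f (of_real s * e t) * X t)) has_integral
      ((\<Sum>k\<le>N. (cmod (x k))\<^sup>2) + (\<Sum>j\<le>N. (cmod (y j))\<^sup>2)
      + 2 * Re (\<Sum>j\<le>N. \<Sum>k\<le>N. cnj (y j) * x k *
                 (if k \<le> j then of_real s ^ (j - k) * tcoeff f (j - k) else 0)))) {0..1}"
    by (simp add: o_def del: of_real_power of_real_sum)
  then show ?thesis
  proof (rule has_integral_nonneg)
    fix t :: real
    have "cmod (of_real s * e t) < 1"
      using s by (simp add: e_def norm_mult)
    then have "cmod (f (of_real s * e t)) \<le> 1"
      using f by (simp add: unit_bounded_def)
    then show "0 \<le> (cmod (X t))\<^sup>2 + (cmod (Y t))\<^sup>2 + 2 * Re (cnj (Y t) * f (of_real s * e t) * X t)"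
      by (rule norm_bilinear_nonneg)
  qed
qed

text \<open>The matrix \<open>(a\<^bsub>j-k\<^esub>)\<close>, with zeros above the diagonal, is a contraction: applied to
  all multiples of \<open>x\<close> and \<open>y\<close>, the inequality says that the bilinear form is bounded by the
  product of the Euclidean norms. It is the limit \<open>s \<rightarrow> 1\<close> of the previous lemma.\<close>
lemma toeplitz_contraction:
  fixes x y :: "nat \<Rightarrow> complex"
  assumes f: "f \<in> unit_bounded"
  shows "0 \<le> (\<Sum>k\<le>N. (cmod (x k))\<^sup>2) + (\<Sum>j\<le>N. (cmod (y j))\<^sup>2)
      + 2 * Re (\<Sum>j\<le>N. \<Sum>k\<le>N. cnj (y j) * x k * (if k \<le> j then tcoeff f (j - k) else 0))"
proof -
  define S where "S = (\<lambda>s::real. (\<Sum>k\<le>N. (cmod (x k))\<^sup>2) + (\<Sum>j\<le>N. (cmod (y j))\<^sup>2)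
      + 2 * Re (\<Sum>j\<le>N. \<Sum>k\<le>N. cnj (y j) * x k *
                 (if k \<le> j then of_real s ^ (j - k) * tcoeff f (j - k) else 0)))"
  have ev: "eventually (\<lambda>s. 0 \<le> S s) (at_left 1)"
    using eventually_at_left_real[OF zero_less_one]
    by (rule eventually_mono) (unfold S_def, rule toeplitz_contraction_aux[OF f], auto)
  have "((\<lambda>s::real. if k \<le> j then of_real s ^ (j - k) * tcoeff f (j - k) else 0)
      \<longlongrightarrow> (if k \<le> j then of_real 1 ^ (j - k) * tcoeff f (j - k) else 0)) (at_left 1)" for j k
    by (cases "k \<le> j") (auto intro!: tendsto_eq_intros)
  then have "(S \<longlongrightarrow> S 1) (at_left 1)"
    unfolding S_def by (intro tendsto_add tendsto_mult tendsto_Re tendsto_sum tendsto_const)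
  from tendsto_lowerbound[OF this ev] show ?thesis
    by (simp only: S_def of_real_1 power_one mult_1 trivial_limit_at_left_real not_False_eq_True)
qed

text \<open>Sums of vectors supported on one index at one end and \<open>h + 1\<close> indices at the other end.\<close>
lemma sum_front_and_tail:
  fixes v :: "nat \<Rightarrow> 'a :: comm_monoid_add"
  assumes "h < N"
  shows "(\<Sum>k\<le>N. if k = 0 then u else if N - h \<le> k then v (N - k) else 0) = u + (\<Sum>i\<le>h. v i)"
proof -
  have "(\<Sum>k\<le>N. if k = 0 then u else if N - h \<le> k then v (N - k) else 0)
      = u + (\<Sum>k\<in>{..N} - {0}. if k = 0 then u else if N - h \<le> k then v (N - k) else 0)"
    by (subst sum.remove[of _ 0]) auto
  also have "(\<Sum>k\<in>{..N} - {0}. if k = 0 then u else if N - h \<le> k then v (N - k) else 0)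
      = (\<Sum>k\<in>{N-h..N}. v (N - k))"
    using assms by (intro sum.mono_neutral_cong_right) auto
  also have "\<dots> = (\<Sum>i\<le>h. v i)"
    using assms by (intro sum.reindex_bij_witness[of _ "\<lambda>i. N - i" "\<lambda>i. N - i"]) auto
  finally show ?thesis .
qed

lemma sum_last_and_front:
  fixes v :: "nat \<Rightarrow> 'a :: comm_monoid_add"
  assumes "h < N"
  shows "(\<Sum>j\<le>N. if j = N then u else if j \<le> h then v j else 0) = u + (\<Sum>i\<le>h. v i)"
proof -
  have "(\<Sum>j\<le>N. if j = N then u else if j \<le> h then v j else 0)
      = u + (\<Sum>j\<in>{..N} - {N}. if j = N then u else if j \<le> h then v j else 0)"
    by (subst sum.remove[of _ N]) auto
  also have "(\<Sum>j\<in>{..N} - {N}. if j = N then u else if j \<le> h then v j else 0) = (\<Sum>i\<le>h. v i)"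
    using assms by (intro sum.mono_neutral_cong_right) auto
  finally show ?thesis .
qed

text \<open>A common form of Carlson's inequalities with free weights \<open>t\<close>. The Toeplitz matrix of size
  \<open>N + 1\<close> is tested on vectors \<open>x\<close>, \<open>y\<close> that pick out the entry \<open>a\<^sub>N\<close> in the lower left corner,
  and whose other entries are weighted: for \<open>y\<close>, the negated first \<open>h + 1\<close> entries of the first
  column, and for \<open>x\<close>, up to a constant factor, the conjugated last \<open>h + 1\<close> entries of
  the last row. If \<open>2h < N\<close>, these additional parts of \<open>x\<close> and \<open>y\<close> meet only zero entries of the
  matrix; if \<open>2h = N\<close>, they meet in one diagonal entry, which produces the term with \<open>a\<^sub>0\<close>.\<close>
lemma carlson_weighted:
  fixes t :: "nat \<Rightarrow> real"
  assumes f: "f \<in> unit_bounded" and N: "1 \<le> N" "2 * h \<le> N"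
  shows "cmod (tcoeff f N) \<le> 1 + (\<Sum>i\<le>h. ((t i)\<^sup>2 - 2 * t i) * (cmod (tcoeff f i))\<^sup>2)
            + (if 2 * h = N then (t h)\<^sup>2 * (cmod (tcoeff f h))\<^sup>2 * cmod (tcoeff f 0) else 0)"
proof -
  define a where "a = tcoeff f"
  define c where "c = a N"
  \<comment> \<open>A unimodular factor that turns \<open>c\<close> into \<open>- |c|\<close>.\<close>
  define \<zeta> where "\<zeta> = (if c = 0 then 1 else - c / of_real (cmod c))"
  have zeta: "cmod \<zeta> = 1" "cnj \<zeta> * c = - of_real (cmod c)"
    by (auto simp: \<zeta>_def norm_divide mult.commute[of "cnj c"] power2_eq_square
        simp flip: complex_norm_square)
  have zz: "cnj \<zeta> * \<zeta> = 1"
    using complex_norm_square[of \<zeta>] zeta(1) by (simp add: mult.commute)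
  have hN: "h < N" using N by auto
  define v where "v = (\<lambda>i. - \<zeta> * of_real (t i) * cnj (a i))"
  define w where "w = (\<lambda>i. - of_real (t i) * a i)"
  define x where "x = (\<lambda>k. if k = 0 then 1 else if N - h \<le> k then v (N - k) else 0)"
  define y where "y = (\<lambda>j. if j = N then \<zeta> else if j \<le> h then w j else 0)"
  define T where "T = (\<lambda>j k. if k \<le> j then a (j - k) else 0)"
  define Q where "Q = (\<Sum>i\<le>h. (t i)\<^sup>2 * (cmod (a i))\<^sup>2)"
  define L where "L = (\<Sum>i\<le>h. t i * (cmod (a i))\<^sup>2)"
  have sx: "(\<Sum>k\<le>N. (cmod (x k))\<^sup>2) = 1 + Q"
  proof -
    have "(\<Sum>k\<le>N. (cmod (x k))\<^sup>2)
        = (\<Sum>k\<le>N. if k = 0 then 1 else if N - h \<le> k then (cmod (v (N - k)))\<^sup>2 else 0)"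
      by (intro sum.cong) (auto simp: x_def)
    also have "\<dots> = 1 + (\<Sum>i\<le>h. (cmod (v i))\<^sup>2)"
      by (rule sum_front_and_tail[OF hN])
    finally show ?thesis by (simp add: Q_def v_def norm_mult zeta power_mult_distrib)
  qed
  have sy: "(\<Sum>j\<le>N. (cmod (y j))\<^sup>2) = 1 + Q"
  proof -
    have "(\<Sum>j\<le>N. (cmod (y j))\<^sup>2)
        = (\<Sum>j\<le>N. if j = N then 1 else if j \<le> h then (cmod (w j))\<^sup>2 else 0)"
      by (intro sum.cong) (auto simp: y_def zeta)
    also have "\<dots> = 1 + (\<Sum>i\<le>h. (cmod (w i))\<^sup>2)"
      by (rule sum_last_and_front[OF hN])
    finally show ?thesis by (simp add: Q_def w_def norm_mult power_mult_distrib)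
  qed
  define I where "I = (\<lambda>j. \<Sum>k\<le>N. x k * T j k)"
  have I: "I j = a j + (\<Sum>i\<le>h. v i * T j (N - i))" for j
  proof -
    have "I j = (\<Sum>k\<le>N. if k = 0 then a j else if N - h \<le> k then v (N - k) * T j (N - (N - k)) else 0)"
      unfolding I_def by (intro sum.cong) (auto simp: x_def T_def)
    also have "\<dots> = a j + (\<Sum>i\<le>h. v i * T j (N - i))"
      by (rule sum_front_and_tail[OF hN])
    finally show ?thesis .
  qed
  have IN: "cnj \<zeta> * I N = - of_real (cmod c) - of_real L"
  proof -
    have "cnj \<zeta> * (v i * T N (N - i)) = - of_real (t i * (cmod (a i))\<^sup>2)" if "i \<le> h" for i
    proof -
      have "T N (N - i) = a i" using that hN by (simp add: T_def)
      then have "cnj \<zeta> * (v i * T N (N - i)) = - (cnj \<zeta> * \<zeta>) * of_real (t i) * (a i * cnj (a i))"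
        by (simp add: v_def mult_ac)
      then show ?thesis by (simp add: zz complex_norm_square del: of_real_power)
    qed
    then show ?thesis
      unfolding I L_def distrib_left sum_distrib_left
      using zeta(2) by (simp add: c_def sum_negf)
  qed
  have Ij: "cnj (w j) * I j = - of_real (t j * (cmod (a j))\<^sup>2)
      + (if j = h then if 2 * h = N then cnj (w h) * v h * a 0 else 0 else 0)" if "j \<le> h" for j
  proof -
    have "(\<Sum>i\<le>h. v i * T j (N - i)) = (\<Sum>i\<le>h. if i = h then if j = h \<and> 2 * h = N then v h * a 0 else 0 else 0)"
      using that N by (intro sum.cong) (auto simp: T_def)
    then have "I j = a j + (if j = h \<and> 2 * h = N then v h * a 0 else 0)"
      by (simp add: I)
    moreover have "cnj (w j) * a j = - of_real (t j * (cmod (a j))\<^sup>2)"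
      by (simp add: w_def complex_norm_square mult_ac del: of_real_power)
    ultimately show ?thesis by (auto simp: distrib_left)
  qed
  define R where "R = (if 2 * h = N then cnj (w h) * v h * a 0 else 0)"
  have "(\<Sum>j\<le>N. \<Sum>k\<le>N. cnj (y j) * x k * T j k) = (\<Sum>j\<le>N. cnj (y j) * I j)"
    by (simp add: I_def sum_distrib_left mult_ac)
  also have "\<dots> = (\<Sum>j\<le>N. if j = N then cnj \<zeta> * I N else if j \<le> h then cnj (w j) * I j else 0)"
    by (intro sum.cong) (auto simp: y_def)
  also have "\<dots> = cnj \<zeta> * I N + (\<Sum>j\<le>h. cnj (w j) * I j)"
    by (rule sum_last_and_front[OF hN])
  also have "(\<Sum>j\<le>h. cnj (w j) * I j)
      = (\<Sum>j\<le>h. - of_real (t j * (cmod (a j))\<^sup>2) + (if j = h then R else 0))"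
    by (intro sum.cong) (auto simp: Ij R_def)
  also have "\<dots> = - of_real L + R"
    by (simp only: sum.distrib sum_negf L_def of_real_sum) simp
  finally have "(\<Sum>j\<le>N. \<Sum>k\<le>N. cnj (y j) * x k * T j k) = of_real (- cmod c - 2 * L) + R"
    by (simp add: IN)
  moreover have "0 \<le> (\<Sum>k\<le>N. (cmod (x k))\<^sup>2) + (\<Sum>j\<le>N. (cmod (y j))\<^sup>2)
      + 2 * Re (\<Sum>j\<le>N. \<Sum>k\<le>N. cnj (y j) * x k * T j k)"
    using toeplitz_contraction[OF f, where N = N and x = x and y = y]
    by (simp only: T_def a_def)
  ultimately have "0 \<le> 2 * (1 + Q) + 2 * (- cmod c - 2 * L + Re R)"
    by (simp add: sx sy)
  moreover have "Re R \<le> (if 2 * h = N then (t h)\<^sup>2 * (cmod (a h))\<^sup>2 * cmod (a 0) else 0)"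
    using complex_Re_le_cmod[of R]
    by (auto simp: R_def w_def v_def norm_mult zeta power2_eq_square mult_ac)
  moreover have "(\<Sum>i\<le>h. ((t i)\<^sup>2 - 2 * t i) * (cmod (a i))\<^sup>2) = Q - 2 * L"
    by (simp add: Q_def L_def sum_distrib_left algebra_simps flip: sum_subtractf)
  ultimately show ?thesis
    by (cases "2 * h = N") (simp_all add: a_def c_def)
qed

lemma tcoeff_odd_le:
  assumes f: "f \<in> unit_bounded"
  shows "cmod (tcoeff f (2 * n + 1)) \<le> 1 - (\<Sum>i\<le>n. (cmod (tcoeff f i))\<^sup>2)"
  using carlson_weighted[OF f, of "2 * n + 1" n "\<lambda>_. 1"] by (simp add: sum_negf split: if_splits)

lemma tcoeff_even_le:
  assumes f: "f \<in> unit_bounded" and n: "1 \<le> n"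
  shows "cmod (tcoeff f (2 * n)) \<le> 1 - (\<Sum>i<n. (cmod (tcoeff f i))\<^sup>2)
           - (cmod (tcoeff f n))\<^sup>2 / (1 + cmod (tcoeff f 0))"
proof -
  let ?a = "cmod (tcoeff f 0)" and ?A = "(cmod (tcoeff f n))\<^sup>2"
  \<comment> \<open>The last weight minimises \<open>(1 + |a\<^sub>0|) t\<^sup>2 - 2 t\<close>, the factor of \<open>|a\<^sub>n|\<^sup>2\<close>; the others
    minimise \<open>t\<^sup>2 - 2 t\<close>.\<close>
  define t where "t = (\<lambda>i. if i = n then 1 / (1 + ?a) else 1)"
  have pos: "1 + ?a > 0" using norm_ge_zero[of "tcoeff f 0"] by linarith
  have "{..n} = insert n {..<n}" by auto
  then have "(\<Sum>i\<le>n. ((t i)\<^sup>2 - 2 * t i) * (cmod (tcoeff f i))\<^sup>2)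
      = ((t n)\<^sup>2 - 2 * t n) * ?A + (\<Sum>i<n. - (cmod (tcoeff f i))\<^sup>2)"
    by (simp add: t_def)
  moreover have "((t n)\<^sup>2 - 2 * t n) * ?A + (t n)\<^sup>2 * ?A * ?a = - (?A / (1 + ?a))"
  proof -
    have "((t n)\<^sup>2 - 2 * t n) * ?A + (t n)\<^sup>2 * ?A * ?a = ?A * ((t n)\<^sup>2 * (1 + ?a) - 2 * t n)"
      by (simp add: algebra_simps)
    also have "(t n)\<^sup>2 * (1 + ?a) = t n"
      using pos by (simp add: t_def power2_eq_square)
    finally show ?thesis by (simp add: t_def)
  qed
  ultimately show ?thesis
    using carlson_weighted[OF f, of "2 * n" n t] n by (simp add: sum_negf)
qed

lemma sum_sq_tcoeff_le:
  assumes "f \<in> unit_bounded"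
  shows "(\<Sum>i\<le>n. (cmod (tcoeff f i))\<^sup>2) \<le> 1"
  using tcoeff_odd_le[OF assms, of n] norm_ge_zero[of "tcoeff f (2 * n + 1)"] by linarith

lemma tcoeff_0: "tcoeff f 0 = f 0"
  by (simp add: tcoeff_eq_deriv)

lemma cmod_tcoeff_0_le:
  assumes "f \<in> unit_bounded"
  shows "cmod (tcoeff f 0) \<le> 1"
  using assms by (simp add: tcoeff_0 unit_bounded_def)

section \<open>The refined Bohr inequality\<close>

text \<open>Keeping the remainder \<open>D M\<close> in the bound makes the induction exact: in the step the even
  and the odd Carlson inequality are used once each, and otherwise there is equality.\<close>
lemma refined_bohr_partial:
  assumes f: "f \<in> unit_bounded" and r: "0 \<le> r" "r < 1"
  defines "a \<equiv> cmod (tcoeff f 0)"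
  defines "C \<equiv> (1 + a * r) / ((1 + a) * (1 - r))"
  defines "D \<equiv> \<lambda>M. 1 - (\<Sum>i\<le>M. (cmod (tcoeff f i))\<^sup>2)"
  shows "(\<Sum>n<2 * M. cmod (tcoeff f (n + 2)) * r ^ (n + 2))
       + C * (\<Sum>n<M. (cmod (tcoeff f (n + 1)))\<^sup>2 * r ^ (2 * (n + 1)))
       \<le> (1 - a\<^sup>2) * r\<^sup>2 / (1 - r) - r ^ (2 * M + 2) / (1 - r) * D M"
proof (induction M)
  case 0
  then show ?case by (simp add: D_def a_def power2_eq_square mult_ac)
next
  case (Suc M)
  define A where "A = (cmod (tcoeff f (M + 1)))\<^sup>2"
  define q where "q = r ^ (2 * M + 2)"
  have q: "q \<ge> 0" using r by (simp add: q_def)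
  have a: "a \<ge> 0" by (simp add: a_def)
  have DS: "D (Suc M) = D M - A" by (simp add: D_def A_def)
  have "cmod (tcoeff f (2 * (M + 1))) \<le> D M - A / (1 + a)"
    using tcoeff_even_le[OF f, of "M + 1"]
    by (simp add: D_def A_def a_def lessThan_Suc_atMost)
  from mult_right_mono[OF this q]
  have even: "cmod (tcoeff f (2 * M + 2)) * r ^ (2 * M + 2) \<le> (D M - A / (1 + a)) * q"
    by (simp add: q_def)
  have "cmod (tcoeff f (2 * (M + 1) + 1)) \<le> D M - A"
    using tcoeff_odd_le[OF f, of "M + 1"] by (simp add: D_def A_def)
  from mult_right_mono[OF this, of "q * r"]
  have odd: "cmod (tcoeff f (2 * M + 3)) * r ^ (2 * M + 3) \<le> (D M - A) * (q * r)"
    using q r by (simp add: q_def numeral_3_eq_3 mult_ac)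
  have "C * A = A / (1 + a) + A * r / (1 - r)"
  proof -
    have "1 + a > 0" "1 - r > 0" using a r by linarith+
    then show ?thesis by (simp add: C_def field_simps)
  qed
  then have "(D M - A / (1 + a)) * q + (D M - A) * (q * r) + C * A * q
      = q * (D M + (D M - A) * r + A * r / (1 - r))"
    by (simp add: algebra_simps)
  also have "\<dots> = q / (1 - r) * D M - q * r\<^sup>2 / (1 - r) * (D M - A)"
  proof -
    have "1 - r > 0" using r by simp
    then have "D M + (D M - A) * r + A * r / (1 - r) = (D M - r\<^sup>2 * (D M - A)) / (1 - r)"
      by (simp add: field_simps power2_eq_square)
    then show ?thesis
      by (simp add: right_diff_distrib diff_divide_distrib mult_ac)
  qed
  finally have step: "(D M - A / (1 + a)) * q + (D M - A) * (q * r) + C * A * q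
      = q / (1 - r) * D M - q * r\<^sup>2 / (1 - r) * (D M - A)" .
  have S1: "(\<Sum>n<2 * Suc M. cmod (tcoeff f (n + 2)) * r ^ (n + 2))
      = (\<Sum>n<2 * M. cmod (tcoeff f (n + 2)) * r ^ (n + 2))
        + cmod (tcoeff f (2 * M + 2)) * r ^ (2 * M + 2) + cmod (tcoeff f (2 * M + 3)) * r ^ (2 * M + 3)"
    by (simp add: numeral_3_eq_3)
  have S2: "C * (\<Sum>n<Suc M. (cmod (tcoeff f (n + 1)))\<^sup>2 * r ^ (2 * (n + 1)))
      = C * (\<Sum>n<M. (cmod (tcoeff f (n + 1)))\<^sup>2 * r ^ (2 * (n + 1))) + C * A * q"
    by (simp add: A_def q_def algebra_simps)
  have S3: "r ^ (2 * Suc M + 2) = q * r\<^sup>2"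
    by (simp add: q_def power2_eq_square mult_ac)
  have combine: "x + e1 + e2 + (y + c) \<le> B - T'"
    if "x + y \<le> B - T" "e1 \<le> b1" "e2 \<le> b2" "b1 + b2 + c = T - T'"
    for x y e1 e2 c b1 b2 B T T' :: real
    using that by linarith
  show ?case
    unfolding S1 S2 S3 DS by (rule combine[OF Suc[folded q_def] even odd step])
qed

lemma refined_bohr:
  assumes f: "f \<in> unit_bounded" and r: "0 \<le> r" "r < 1"
  defines "a \<equiv> cmod (tcoeff f 0)"
  shows "majorant_tail 2 f r + (1 + a * r) / ((1 + a) * (1 - r)) * sqnorm0 f r
           \<le> (1 - a\<^sup>2) * r\<^sup>2 / (1 - r)"
proof -
  let ?C = "(1 + a * r) / ((1 + a) * (1 - r))"
  have double: "filterlim (\<lambda>M::nat. 2 * M) at_top sequentially"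
    by (rule filterlim_subseq) (simp add: strict_mono_def)
  have "(\<lambda>N. \<Sum>n<N. cmod (tcoeff f (n + 2)) * r ^ (n + 2)) \<longlonglongrightarrow> majorant_tail 2 f r"
    unfolding majorant_tail_def by (rule summable_LIMSEQ[OF summable_majorant[OF f r]])
  from filterlim_compose[OF this double]
  have "(\<lambda>M. \<Sum>n<2 * M. cmod (tcoeff f (n + 2)) * r ^ (n + 2)) \<longlonglongrightarrow> majorant_tail 2 f r" .
  moreover have "(\<lambda>M. \<Sum>n<M. (cmod (tcoeff f (n + 1)))\<^sup>2 * r ^ (2 * (n + 1))) \<longlonglongrightarrow> sqnorm0 f r"
    unfolding sqnorm0_def by (rule summable_LIMSEQ[OF summable_sqnorm0[OF f r]])
  ultimately have "(\<lambda>M. (\<Sum>n<2 * M. cmod (tcoeff f (n + 2)) * r ^ (n + 2))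
       + ?C * (\<Sum>n<M. (cmod (tcoeff f (n + 1)))\<^sup>2 * r ^ (2 * (n + 1))))
     \<longlonglongrightarrow> majorant_tail 2 f r + ?C * sqnorm0 f r"
    by (intro tendsto_intros)
  then show ?thesis
  proof (rule LIMSEQ_le_const2, intro exI allI impI)
    fix M :: nat
    have "0 \<le> r ^ (2 * M + 2) / (1 - r) * (1 - (\<Sum>i\<le>M. (cmod (tcoeff f i))\<^sup>2))"
      using r sum_sq_tcoeff_le[OF f, of M] by simp
    then show "(\<Sum>n<2 * M. cmod (tcoeff f (n + 2)) * r ^ (n + 2))
       + ?C * (\<Sum>n<M. (cmod (tcoeff f (n + 1)))\<^sup>2 * r ^ (2 * (n + 1)))
       \<le> (1 - a\<^sup>2) * r\<^sup>2 / (1 - r)"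
      using refined_bohr_partial[OF f r, of M] by (simp add: a_def)
  qed
qed

section \<open>Schwarz and Schwarz--Pick inequalities\<close>

text \<open>The Schwarz lemma for a zero of order at least \<open>m\<close>: the maximum principle is applied to
  \<open>f(z) / z\<^sup>m\<close> on discs of radius \<open>s < 1\<close>.\<close>
lemma norm_le_power_of_zero:
  assumes f: "f \<in> unit_bounded" and zero: "\<And>k. k < m \<Longrightarrow> tcoeff f k = 0"
    and z: "cmod z < 1"
  shows "cmod (f z) \<le> cmod z ^ m"
proof -
  define g where "g = (\<lambda>z. \<Sum>n. tcoeff f (n + m) * z ^ n)"
  have prod: "(\<lambda>n. tcoeff f (n + m) * w ^ (n + m)) sums f w" if "cmod w < 1" for w
    using sums_split_initial_segment[OF tcoeff_sums[OF f that], of m] zero by simp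
  have sum_g: "(\<lambda>n. tcoeff f (n + m) * w ^ n) sums g w" if w: "cmod w < 1" for w
  proof (cases "w = 0")
    case True
    then show ?thesis
      using powser_sums_zero[of "\<lambda>n. tcoeff f (n + m)"] by (simp add: g_def sums_iff)
  next
    case False
    have "(\<lambda>n. tcoeff f (n + m) * w ^ (n + m) / w ^ m) sums (f w / w ^ m)"
      by (intro sums_divide prod w)
    then have "(\<lambda>n. tcoeff f (n + m) * w ^ n) sums (f w / w ^ m)"
      using False by (simp add: power_add)
    then show ?thesis
      unfolding g_def by (simp add: sums_iff)
  qed
  have fg: "f w = w ^ m * g w" if w: "cmod w < 1" for w
  proof -
    have "(\<lambda>n. tcoeff f (n + m) * w ^ (n + m)) sums (w ^ m * g w)"
      using sums_mult[OF sum_g[OF w], of "w ^ m"] by (simp add: power_add mult_ac)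
    with prod[OF w] show ?thesis by (rule sums_unique2)
  qed
  have holg: "g holomorphic_on ball 0 1"
    by (rule power_series_holomorphic[of _ _ "\<lambda>n. tcoeff f (n + m)"]) (simp add: sum_g)
  have "cmod (g z) * s ^ m \<le> 1" if s: "cmod z < s" "s < 1" for s
  proof -
    have s0: "s > 0" using s norm_ge_zero[of z] by linarith
    have "cmod (g z) \<le> 1 / s ^ m"
    proof (rule maximum_modulus_frontier[where f = g and S = "cball 0 s"])
      show "g holomorphic_on interior (cball 0 s)"
        using s by (intro holomorphic_on_subset[OF holg]) auto
      show "continuous_on (closure (cball 0 s)) g"
        using s by (intro holomorphic_on_imp_continuous_on holomorphic_on_subset[OF holg]) auto
      show "cmod (g w) \<le> 1 / s ^ m" if "w \<in> frontier (cball 0 s)" for w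
      proof -
        have w: "cmod w = s" using that s0 by (simp add: frontier_cball)
        then have "cmod (f w) \<le> 1" using f s by (simp add: unit_bounded_def)
        moreover have "cmod (f w) = s ^ m * cmod (g w)"
          using w s by (subst fg) (simp_all add: norm_mult norm_power)
        ultimately show ?thesis
          using s0 by (simp add: field_simps)
      qed
    qed (use s in auto)
    then show ?thesis using s0 by (simp add: field_simps)
  qed
  then have "eventually (\<lambda>s. cmod (g z) * s ^ m \<le> 1) (at_left 1)"
    by (intro eventually_mono[OF eventually_at_left_real[OF z]]) auto
  moreover have "((\<lambda>s. cmod (g z) * s ^ m) \<longlongrightarrow> cmod (g z) * 1 ^ m) (at_left 1)"
    by (intro tendsto_intros)
  ultimately have "cmod (g z) * 1 ^ m \<le> 1"
    by (intro tendsto_upperbound) auto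
  then show ?thesis
    using fg[OF z] by (simp add: norm_mult norm_power mult_left_le)
qed

text \<open>Here \<open>b\<close> may lie on the unit circle, so that boundary values of \<open>f\<close> need not be excluded
  when \<open>f\<close> is composed with the map.\<close>
lemma norm_moebius_le_1:
  assumes "cmod b \<le> 1" "cmod c < 1"
  shows "1 - cnj c * b \<noteq> 0" and "cmod ((b - c) / (1 - cnj c * b)) \<le> 1"
proof -
  have "cmod (cnj c * b) < 1"
    using mult_mono[OF order_refl assms(1), of "cmod c"] assms(2) by (simp add: norm_mult)
  then show nz: "1 - cnj c * b \<noteq> 0" by auto
  have "(cmod b)\<^sup>2 \<le> 1" "(cmod c)\<^sup>2 \<le> 1"
    using assms by (auto intro!: power_le_one)
  then have "0 \<le> (1 - (cmod b)\<^sup>2) * (1 - (cmod c)\<^sup>2)"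
    by (intro mult_nonneg_nonneg) linarith+
  moreover have "(cmod (1 - cnj c * b))\<^sup>2 - (cmod (b - c))\<^sup>2 = (1 - (cmod b)\<^sup>2) * (1 - (cmod c)\<^sup>2)"
    unfolding cmod_power2 by (simp add: algebra_simps power2_eq_square)
  ultimately have "(cmod (b - c))\<^sup>2 \<le> (cmod (1 - cnj c * b))\<^sup>2"
    by linarith
  then have "cmod (b - c) \<le> cmod (1 - cnj c * b)"
    by (rule power2_le_imp_le) (rule norm_ge_zero)
  then show "cmod ((b - c) / (1 - cnj c * b)) \<le> 1"
    using nz by (simp add: norm_divide)
qed

lemma moebius_real_mono:
  fixes a b s :: real
  assumes "0 \<le> a" "a \<le> 1" "0 \<le> b" "b \<le> s"
  shows "(b + a) / (1 + a * b) \<le> (s + a) / (1 + a * s)"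
proof -
  have pos: "1 + a * b > 0" "1 + a * s > 0"
    using assms by (simp_all add: add_pos_nonneg)
  have "a\<^sup>2 \<le> 1" using assms by (intro power_le_one)
  then have "0 \<le> (s - b) * (1 - a\<^sup>2)"
    using assms by (intro mult_nonneg_nonneg) linarith+
  then have "(b + a) * (1 + a * s) \<le> (s + a) * (1 + a * b)"
    by (simp add: algebra_simps power2_eq_square)
  then show ?thesis
    using pos by (simp add: frac_le_eq divide_le_0_iff)
qed

lemma norm_moebius_inverse_le:
  assumes g: "cmod g \<le> 1" and c: "cmod c < 1"
  shows "cmod ((g + c) / (1 + cnj c * g)) \<le> (cmod g + cmod c) / (1 + cmod c * cmod g)"
proof -
  define a b x where "a = cmod c" and "b = cmod g" and "x = Re (cnj c * g)"
  have ab: "0 \<le> a" "a < 1" "0 \<le> b" "b \<le> 1"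
    using assms by (auto simp: a_def b_def)
  have x: "x \<le> a * b"
    using complex_Re_le_cmod[of "cnj c * g"] by (simp add: x_def a_def b_def norm_mult)
  have num: "(cmod (g + c))\<^sup>2 = a\<^sup>2 + b\<^sup>2 + 2 * x"
    unfolding a_def b_def x_def cmod_power2 by (simp add: power2_eq_square algebra_simps)
  have den: "(cmod (1 + cnj c * g))\<^sup>2 = 1 + a\<^sup>2 * b\<^sup>2 + 2 * x"
    unfolding a_def b_def x_def cmod_power2 by (simp add: power2_eq_square algebra_simps)
  have nz: "1 + cnj c * g \<noteq> 0"
    using norm_moebius_le_1(1)[of g "- c"] g c by simp
  have pos: "1 + a * b > 0"
    using ab by (simp add: add_pos_nonneg)
  have "a\<^sup>2 \<le> 1" "b\<^sup>2 \<le> 1"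
    using ab by (auto intro!: power_le_one)
  then have "0 \<le> 2 * (a * b - x) * (1 - a\<^sup>2) * (1 - b\<^sup>2)"
    using x by (intro mult_nonneg_nonneg) linarith+
  moreover have "((a + b) * cmod (1 + cnj c * g))\<^sup>2 - (cmod (g + c) * (1 + a * b))\<^sup>2
      = 2 * (a * b - x) * (1 - a\<^sup>2) * (1 - b\<^sup>2)"
    unfolding power_mult_distrib num den by (simp add: power2_eq_square algebra_simps)
  ultimately have "(cmod (g + c) * (1 + a * b))\<^sup>2 \<le> ((a + b) * cmod (1 + cnj c * g))\<^sup>2"
    by linarith
  then have "cmod (g + c) * (1 + a * b) \<le> (a + b) * cmod (1 + cnj c * g)"
    by (rule power2_le_imp_le) (use ab in simp)
  then have "cmod ((g + c) / (1 + cnj c * g)) \<le> (b + a) / (1 + a * b)"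
    using nz pos by (simp add: norm_divide field_simps)
  then show ?thesis by (simp add: a_def b_def)
qed

lemma schwarz_pick_value:
  assumes f: "f \<in> unit_bounded" and z: "cmod z < 1"
  defines "a \<equiv> cmod (tcoeff f 0)"
  shows "cmod (f z) \<le> (cmod z + a) / (1 + a * cmod z)"
proof (cases "a < 1")
  case False
  then have "a = 1" using cmod_tcoeff_0_le[OF f] by (simp add: a_def)
  moreover have "cmod (f z) \<le> 1" using f z by (simp add: unit_bounded_def)
  ultimately show ?thesis
    by (simp add: add.commute[of "cmod z"] add_nonneg_eq_0_iff)
next
  case True
  define c where "c = f 0"
  have c: "cmod c < 1" using True by (simp add: c_def a_def tcoeff_0)
  define g where "g = (\<lambda>z. (f z - c) / (1 - cnj c * f z))"
  have holf: "f holomorphic_on ball 0 1" and fb: "\<And>w. w \<in> ball 0 1 \<Longrightarrow> cmod (f w) \<le> 1"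
    using f by (auto simp: unit_bounded_iff)
  have "g \<in> unit_bounded"
    unfolding unit_bounded_iff g_def
    by (intro conjI ballI holomorphic_intros holf norm_moebius_le_1 fb c)
  moreover have "tcoeff g 0 = 0" by (simp add: tcoeff_0 g_def c_def)
  ultimately have gz: "cmod (g z) \<le> cmod z"
    using norm_le_power_of_zero[of g 1 z] z by simp
  have "cmod ((g z + c) / (1 + cnj c * g z)) \<le> (cmod (g z) + cmod c) / (1 + cmod c * cmod (g z))"
    by (intro norm_moebius_inverse_le c) (use gz z in auto)
  also have "\<dots> \<le> (cmod z + cmod c) / (1 + cmod c * cmod z)"
    by (intro moebius_real_mono) (use c gz in auto)
  finally have "cmod ((g z + c) / (1 + cnj c * g z)) \<le> (cmod z + cmod c) / (1 + cmod c * cmod z)" .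
  moreover have "(g z + c) / (1 + cnj c * g z) = f z"
  proof -
    have d: "1 - cnj c * f z \<noteq> 0"
      using z by (intro norm_moebius_le_1 fb c) auto
    have e: "1 - c * cnj c \<noteq> 0"
      using norm_moebius_le_1(1)[of c c] c by (simp add: mult.commute)
    have "g z + c = f z * (1 - c * cnj c) / (1 - cnj c * f z)"
      using d by (simp add: g_def field_simps)
    moreover have "1 + cnj c * g z = (1 - c * cnj c) / (1 - cnj c * f z)"
      using d by (simp add: g_def field_simps)
    ultimately show ?thesis using d e by simp
  qed
  ultimately show ?thesis by (simp add: a_def c_def tcoeff_0)
qed

text \<open>The automorphism \<open>p\<close> of the disc with \<open>p 0 = w\<close> moves the inequality to the origin, where it
  is the coefficient bound \<open>|a\<^sub>1| \<le> 1 - |a\<^sub>0|\<^sup>2\<close>.\<close>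
lemma schwarz_pick_deriv:
  assumes f: "f \<in> unit_bounded" and w: "cmod w < 1"
  shows "cmod (deriv f w) * (1 - (cmod w)\<^sup>2) \<le> 1 - (cmod (f w))\<^sup>2"
proof -
  define p where "p = Moebius_function 0 (- w)"
  have holf: "f holomorphic_on ball 0 1" and fb: "\<And>w. w \<in> ball 0 1 \<Longrightarrow> cmod (f w) \<le> 1"
    using f by (auto simp: unit_bounded_iff)
  have p0: "p 0 = w" by (simp add: p_def Moebius_function_of_zero)
  have pb: "p z \<in> ball 0 1" if "z \<in> ball 0 1" for z
    using that w by (simp add: p_def Moebius_function_norm_lt_1)
  have "f \<circ> p \<in> unit_bounded"
    unfolding unit_bounded_iff
  proof (intro conjI ballI)
    show "f \<circ> p holomorphic_on ball 0 1"
      by (rule holomorphic_on_compose_gen[OF _ holf])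
        (use w pb in \<open>auto simp: p_def intro!: Moebius_function_holomorphic\<close>)
  qed (use pb fb in auto)
  from tcoeff_odd_le[OF this, of 0]
  have "cmod (deriv (f \<circ> p) 0) \<le> 1 - (cmod (f w))\<^sup>2"
    by (simp add: tcoeff_eq_deriv p0)
  moreover have "(p has_field_derivative (1 - of_real ((cmod w)\<^sup>2))) (at 0)"
    unfolding p_def Moebius_function_def
    by (auto intro!: derivative_eq_intros simp: complex_norm_square[symmetric])
  moreover have "(f has_field_derivative deriv f w) (at (p 0))"
    using holf w by (auto simp: p0 intro: holomorphic_derivI)
  ultimately have "cmod (deriv f w * (1 - of_real ((cmod w)\<^sup>2))) \<le> 1 - (cmod (f w))\<^sup>2"
    by (metis DERIV_chain DERIV_imp_deriv)
  moreover have "cmod (1 - of_real ((cmod w)\<^sup>2)) = 1 - (cmod w)\<^sup>2"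
  proof -
    have "1 - complex_of_real ((cmod w)\<^sup>2) = of_real (1 - (cmod w)\<^sup>2)" by simp
    moreover have "(cmod w)\<^sup>2 \<le> 1" using w by (simp add: power_le_one)
    ultimately show ?thesis by (simp only: norm_of_real)
  qed
  ultimately show ?thesis by (simp add: norm_mult del: of_real_power)
qed

section \<open>The two polynomials\<close>

text \<open>The only part of either polynomial that may decrease on \<open>[0, 1]\<close> is of the form
  \<open>x\<^sup>k - x\<^bsup>k+1\<^esup>\<close>. It decreases with slope at most \<open>1\<close>, which the linear term compensates.\<close>
lemma power_diff_power_Suc_le:
  fixes x y :: real
  assumes "0 \<le> x" "x \<le> y" "y \<le> 1"
  shows "x ^ k - x ^ Suc k \<le> y ^ k - y ^ Suc k + (y - x)"
proof -
  have "x ^ k * (1 - y) \<le> y ^ k * (1 - y)"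
    using assms by (intro mult_right_mono power_mono) auto
  moreover have "x ^ k * (y - x) \<le> 1 * (y - x)"
    using assms by (intro mult_right_mono power_le_one) auto
  ultimately show ?thesis by (simp add: algebra_simps)
qed

lemma theta_poly_strict_mono:
  assumes "0 \<le> x" "x < y" "y \<le> 1"
  shows "theta_poly m x < theta_poly m y"
proof -
  have "x ^ (2 * m) - x ^ (2 * m + 1) \<le> y ^ (2 * m) - y ^ (2 * m + 1) + (y - x)"
    using power_diff_power_Suc_le[of x y "2 * m"] assms by simp
  moreover have "x ^ (2 * m + 2) \<le> y ^ (2 * m + 2)"
    by (rule power_mono) (use assms in auto)
  moreover have "x ^ (m + 2) \<le> y ^ (m + 2)"
    by (rule power_mono) (use assms in auto)
  ultimately show ?thesis
    using assms unfolding theta_poly_def by linarith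
qed

lemma vartheta_poly_strict_mono:
  assumes "0 \<le> x" "x < y" "y \<le> 1"
  shows "vartheta_poly m x < vartheta_poly m y"
proof -
  have "x ^ (2 * m) - x ^ (2 * m + 1) \<le> y ^ (2 * m) - y ^ (2 * m + 1) + (y - x)"
    using power_diff_power_Suc_le[of x y "2 * m"] assms by simp
  moreover have "x ^ (2 * m + 2) \<le> y ^ (2 * m + 2)"
    by (rule power_mono) (use assms in auto)
  moreover have "x ^ (m + 2) \<le> y ^ (m + 2)"
    by (rule power_mono) (use assms in auto)
  ultimately show ?thesis
    using assms unfolding vartheta_poly_def by linarith
qed

lemma ex1_root_unit_interval:
  fixes p :: "real \<Rightarrow> real"
  assumes cont: "continuous_on {0..1} p" and mono: "\<And>x y. 0 \<le> x \<Longrightarrow> x < y \<Longrightarrow> y \<le> 1 \<Longrightarrow> p x < p y"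
    and ends: "p 0 < 0" "0 < p 1"
  shows "\<exists>!x. x \<in> {0<..<1} \<and> p x = 0"
proof -
  obtain x where x: "0 \<le> x" "x \<le> 1" "p x = 0"
    using IVT'[of p 0 0 1] cont ends by auto
  moreover have "x \<noteq> 0" "x \<noteq> 1" using x ends by auto
  moreover have "y = x" if "y \<in> {0<..<1}" "p y = 0" for y
    using mono[of x y] mono[of y x] that x by (cases x y rule: linorder_cases) auto
  ultimately show ?thesis by (intro ex1I[of _ x]) auto
qed

section \<open>The upper bounds\<close>

lemma value_deriv_at_schwarz_function:
  assumes f: "f \<in> unit_bounded" and \<omega>: "\<omega> \<in> unit_bounded_ord m" and m: "m \<ge> 1" and z: "cmod z < 1"
  defines "a \<equiv> cmod (tcoeff f 0)" and "\<rho> \<equiv> cmod z ^ m"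
  shows "cmod (f (\<omega> z)) \<le> (\<rho> + a) / (1 + a * \<rho>)"
    and "cmod (deriv f (\<omega> z)) * (1 - \<rho>\<^sup>2) \<le> 1 - (cmod (f (\<omega> z)))\<^sup>2"
proof -
  define w where "w = \<omega> z"
  have "\<omega> \<in> unit_bounded" "\<And>k. k < m \<Longrightarrow> tcoeff \<omega> k = 0"
    using \<omega> by (auto simp: unit_bounded_ord_def tcoeff_eq_deriv)
  then have w: "cmod w \<le> \<rho>"
    unfolding w_def \<rho>_def by (intro norm_le_power_of_zero z)
  have "\<rho> \<le> cmod z ^ 1"
    unfolding \<rho>_def using m z by (intro power_decreasing) auto
  then have \<rho>: "\<rho> < 1" using z by simp
  have w1: "cmod w < 1" using w \<rho> by simp
  have a: "0 \<le> a" "a \<le> 1" using cmod_tcoeff_0_le[OF f] by (auto simp: a_def)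
  have "cmod (f w) \<le> (cmod w + a) / (1 + a * cmod w)"
    using schwarz_pick_value[OF f w1] by (simp add: a_def)
  also have "\<dots> \<le> (\<rho> + a) / (1 + a * \<rho>)"
    by (intro moebius_real_mono) (use a w in auto)
  finally show "cmod (f (\<omega> z)) \<le> (\<rho> + a) / (1 + a * \<rho>)" by (simp add: w_def)
  have "(cmod w)\<^sup>2 \<le> \<rho>\<^sup>2" using w by (simp add: power_mono)
  then have "cmod (deriv f w) * (1 - \<rho>\<^sup>2) \<le> cmod (deriv f w) * (1 - (cmod w)\<^sup>2)"
    by (intro mult_left_mono) auto
  also have "\<dots> \<le> 1 - (cmod (f w))\<^sup>2" by (rule schwarz_pick_deriv[OF f w1])
  finally show "cmod (deriv f (\<omega> z)) * (1 - \<rho>\<^sup>2) \<le> 1 - (cmod (f (\<omega> z)))\<^sup>2"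
    by (simp add: w_def)
qed

text \<open>After division by \<open>1 - a\<close> or \<open>1 - a\<^sup>2\<close>, the gaps are the signed distances from the bounds for
  the two functionals, in terms of \<open>r\<close>, \<open>\<rho> = r\<^sup>m\<close> and \<open>a = |a\<^sub>0|\<close>, up to \<open>1\<close>; see \<open>G_bound_eq_gap\<close>
  and \<open>H_bound_eq_gap\<close>. The division keeps them informative at \<open>a = 1\<close>, the critical value,
  where the bounds themselves equal \<open>1\<close>.\<close>
definition G_gap :: "real \<Rightarrow> real \<Rightarrow> real \<Rightarrow> real" where
  "G_gap r \<rho> a = (1 - \<rho>) / (1 + a * \<rho>) - (1 + a) * (r / (1 + a * \<rho>)\<^sup>2 + r\<^sup>2 / (1 - r))"

definition H_gap :: "real \<Rightarrow> real \<Rightarrow> real \<Rightarrow> real" where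
  "H_gap r \<rho> a = (1 - \<rho>\<^sup>2 - r) / (1 + a * \<rho>)\<^sup>2 - r\<^sup>2 / (1 - r)"

lemma one_minus_moebius_square:
  fixes a \<rho> :: real
  assumes "1 + a * \<rho> > 0"
  shows "1 - ((\<rho> + a) / (1 + a * \<rho>))\<^sup>2 = (1 - a\<^sup>2) * (1 - \<rho>\<^sup>2) / (1 + a * \<rho>)\<^sup>2"
proof -
  have "1 - ((\<rho> + a) / (1 + a * \<rho>))\<^sup>2 = ((1 + a * \<rho>)\<^sup>2 - (\<rho> + a)\<^sup>2) / (1 + a * \<rho>)\<^sup>2"
    using assms by (simp add: power_divide diff_divide_distrib)
  also have "(1 + a * \<rho>)\<^sup>2 - (\<rho> + a)\<^sup>2 = (1 - a\<^sup>2) * (1 - \<rho>\<^sup>2)"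
    by (simp add: power2_eq_square algebra_simps)
  finally show ?thesis .
qed

lemma G_bound_eq_gap:
  fixes a \<rho> r :: real
  assumes "1 + a * \<rho> > 0"
  shows "(\<rho> + a) / (1 + a * \<rho>) + r * ((1 - a\<^sup>2) / (1 + a * \<rho>)\<^sup>2) + (1 - a\<^sup>2) * r\<^sup>2 / (1 - r)
       = 1 - (1 - a) * G_gap r \<rho> a"
proof -
  have "(\<rho> + a) / (1 + a * \<rho>) = 1 - (1 - a) * ((1 - \<rho>) / (1 + a * \<rho>))"
    using assms by (simp add: field_simps)
  moreover have "r * ((1 - a\<^sup>2) / (1 + a * \<rho>)\<^sup>2) = (1 - a) * ((1 + a) * (r / (1 + a * \<rho>)\<^sup>2))"
    by (simp add: power2_eq_square square_diff_one_factored[symmetric] algebra_simps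
        flip: add_divide_distrib diff_divide_distrib)
  moreover have "(1 - a\<^sup>2) * r\<^sup>2 / (1 - r) = (1 - a) * ((1 + a) * (r\<^sup>2 / (1 - r)))"
    by (simp add: power2_eq_square algebra_simps flip: add_divide_distrib diff_divide_distrib)
  ultimately show ?thesis
    unfolding G_gap_def by (simp only: right_diff_distrib distrib_left)
qed

lemma H_bound_eq_gap:
  fixes a \<rho> r :: real
  assumes "1 + a * \<rho> > 0"
  shows "((\<rho> + a) / (1 + a * \<rho>))\<^sup>2 + r * ((1 - a\<^sup>2) / (1 + a * \<rho>)\<^sup>2) + (1 - a\<^sup>2) * r\<^sup>2 / (1 - r)
       = 1 - (1 - a\<^sup>2) * H_gap r \<rho> a"
proof -
  have "((\<rho> + a) / (1 + a * \<rho>))\<^sup>2 = 1 - (1 - a\<^sup>2) * (1 - \<rho>\<^sup>2) / (1 + a * \<rho>)\<^sup>2"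
    using one_minus_moebius_square[OF assms] by simp
  then show ?thesis
    unfolding H_gap_def by (simp add: right_diff_distrib diff_divide_distrib mult_ac)
qed

lemma G_gap_1:
  assumes "0 \<le> r" "r < 1"
  shows "G_gap r (r ^ m) 1 = - theta_poly m r / ((1 + r ^ m)\<^sup>2 * (1 - r))"
proof -
  define \<rho> where "\<rho> = r ^ m"
  have pos: "1 + \<rho> > 0" "1 - r > 0" using assms by (auto simp: \<rho>_def add_pos_nonneg)
  have \<theta>: "theta_poly m r = 2 * \<rho>\<^sup>2 * r\<^sup>2 - \<rho>\<^sup>2 * r + \<rho>\<^sup>2 + 4 * \<rho> * r\<^sup>2 + 3 * r - 1"
    by (simp add: theta_poly_def \<rho>_def power_add power_mult power2_eq_square
        power_mult_distrib mult_ac)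
  have "G_gap r \<rho> 1 = ((1 - \<rho>) * (1 + \<rho>) * (1 - r) - 2 * r * (1 - r) - 2 * r\<^sup>2 * (1 + \<rho>)\<^sup>2)
      / ((1 + \<rho>)\<^sup>2 * (1 - r))"
    using pos by (simp add: G_gap_def add_divide_distrib diff_divide_distrib power2_eq_square)
  also have "(1 - \<rho>) * (1 + \<rho>) * (1 - r) - 2 * r * (1 - r) - 2 * r\<^sup>2 * (1 + \<rho>)\<^sup>2 = - theta_poly m r"
    by (simp add: \<theta> power2_eq_square algebra_simps)
  finally show ?thesis by (simp add: \<rho>_def)
qed

lemma H_gap_1:
  assumes "0 \<le> r" "r < 1"
  shows "H_gap r (r ^ m) 1 = - vartheta_poly m r / ((1 + r ^ m)\<^sup>2 * (1 - r))"
proof -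
  define \<rho> where "\<rho> = r ^ m"
  have pos: "1 + \<rho> > 0" "1 - r > 0" using assms by (auto simp: \<rho>_def add_pos_nonneg)
  have \<theta>: "vartheta_poly m r = \<rho>\<^sup>2 * r\<^sup>2 - \<rho>\<^sup>2 * r + \<rho>\<^sup>2 + 2 * \<rho> * r\<^sup>2 + 2 * r - 1"
    by (simp add: vartheta_poly_def \<rho>_def power_add power_mult power2_eq_square
        power_mult_distrib mult_ac)
  have "H_gap r \<rho> 1 = ((1 - \<rho>\<^sup>2 - r) * (1 - r) - r\<^sup>2 * (1 + \<rho>)\<^sup>2) / ((1 + \<rho>)\<^sup>2 * (1 - r))"
    using pos by (simp add: H_gap_def diff_divide_distrib)
  also have "(1 - \<rho>\<^sup>2 - r) * (1 - r) - r\<^sup>2 * (1 + \<rho>)\<^sup>2 = - vartheta_poly m r"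
    by (simp add: \<theta> power2_eq_square algebra_simps)
  finally show ?thesis by (simp add: \<rho>_def)
qed

text \<open>In both cases, nonnegativity at \<open>a = 1\<close> carries over to all \<open>a\<close> in \<open>[0, 1]\<close>.\<close>
lemma G_gap_mono:
  assumes r: "0 \<le> r" "r < 1" and \<rho>: "0 \<le> \<rho>" "\<rho> \<le> 1" and a: "0 \<le> a" "a \<le> 1"
  shows "(1 + \<rho>) * G_gap r \<rho> 1 \<le> (1 + a * \<rho>) * G_gap r \<rho> a"
proof -
  have pos: "1 + a * \<rho> > 0" "1 + \<rho> > 0" "r\<^sup>2 / (1 - r) \<ge> 0"
    using assms by (simp_all add: add_pos_nonneg)
  have *: "(1 + b * \<rho>) * G_gap r \<rho> b
      = (1 - \<rho>) - r * ((1 + b) / (1 + b * \<rho>)) - (1 + b) * (1 + b * \<rho>) * (r\<^sup>2 / (1 - r))"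
    if "1 + b * \<rho> > 0" for b
  proof -
    have "D * (p / D - q * (r / D\<^sup>2 + E)) = p - r * (q / D) - q * D * E" if "D > 0" for D p q E :: real
      using that by (simp add: field_simps power2_eq_square)
    then show ?thesis
      unfolding G_gap_def using that by blast
  qed
  have "0 \<le> (1 - a) * (1 - \<rho>)" using \<rho> a by simp
  then have "(1 + a) * (1 + \<rho>) \<le> 2 * (1 + a * \<rho>)" by (simp add: algebra_simps)
  then have "(1 + a) / (1 + a * \<rho>) \<le> 2 / (1 + \<rho>)"
    using pos by (simp add: frac_le_eq divide_le_0_iff)
  then have "r * ((1 + a) / (1 + a * \<rho>)) \<le> r * (2 / (1 + \<rho>))"
    using r by (intro mult_left_mono)
  moreover have "a * \<rho> \<le> \<rho>" using a \<rho> by (simp add: mult_left_le_one_le)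
  then have "(1 + a) * (1 + a * \<rho>) \<le> 2 * (1 + \<rho>)"
    using a pos by (intro mult_mono) auto
  then have "(1 + a) * (1 + a * \<rho>) * (r\<^sup>2 / (1 - r)) \<le> 2 * (1 + \<rho>) * (r\<^sup>2 / (1 - r))"
    using pos by (intro mult_right_mono)
  ultimately show ?thesis
    using *[of a] *[of 1] pos by simp
qed

lemma H_gap_mono:
  assumes "0 \<le> \<rho>" "0 \<le> a" "a \<le> 1" "r \<le> 1 - \<rho>\<^sup>2"
  shows "H_gap r \<rho> 1 \<le> H_gap r \<rho> a"
proof -
  have "1 + a * \<rho> \<le> 1 + \<rho>" "0 < 1 + a * \<rho>"
    using assms by (simp_all add: mult_left_le_one_le add_pos_nonneg)
  then have "(1 - \<rho>\<^sup>2 - r) / (1 + \<rho>)\<^sup>2 \<le> (1 - \<rho>\<^sup>2 - r) / (1 + a * \<rho>)\<^sup>2"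
    using assms by (intro divide_left_mono power_mono mult_pos_pos) auto
  then show ?thesis by (simp add: H_gap_def)
qed

lemma G_fun_le_1:
  assumes f: "f \<in> unit_bounded" and \<omega>: "\<omega> \<in> unit_bounded_ord m" and m: "m \<ge> 1"
    and z: "cmod z < 1" and poly: "theta_poly m (cmod z) \<le> 0"
  shows "G_fun f \<omega> z \<le> 1"
proof -
  define r \<rho> a where "r = cmod z" and "\<rho> = r ^ m" and "a = cmod (tcoeff f 0)"
  define u d v where "u = cmod (f (\<omega> z))" and "d = cmod (deriv f (\<omega> z))"
    and "v = (\<rho> + a) / (1 + a * \<rho>)"
  have r: "0 \<le> r" "r < 1" using z by (auto simp: r_def)
  have \<rho>: "0 \<le> \<rho>" "\<rho> < 1" using r m by (auto simp: \<rho>_def power_less_one_iff)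
  have \<rho>2: "\<rho>\<^sup>2 < 1" using \<rho> by (simp add: power_less_one_iff)
  have a: "0 \<le> a" "a \<le> 1" using cmod_tcoeff_0_le[OF f] by (auto simp: a_def)
  have pos: "1 + a * \<rho> > 0" using a \<rho> by (simp add: add_pos_nonneg)
  have u: "u \<le> v" "d * (1 - \<rho>\<^sup>2) \<le> 1 - u\<^sup>2"
    using value_deriv_at_schwarz_function[OF f \<omega> m z]
    by (simp_all add: u_def v_def d_def a_def \<rho>_def r_def)
  have "0 \<le> (1 - a) * (1 - \<rho>)" using a \<rho> by simp
  then have v1: "v \<le> 1" using pos by (simp add: v_def field_simps)
  \<comment> \<open>Ensures that \<open>u + K (1 - u\<^sup>2)\<close> increases on \<open>[0, 1]\<close>.\<close>
  have slope: "2 * r \<le> 1 - \<rho>\<^sup>2"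
  proof -
    have "r * \<rho>\<^sup>2 \<le> r * 1" using r \<rho>2 by (intro mult_left_mono) auto
    moreover have "0 \<le> \<rho>\<^sup>2 * r\<^sup>2" "0 \<le> \<rho> * r\<^sup>2" using \<rho> by simp_all
    moreover have "theta_poly m r = 2 * (\<rho>\<^sup>2 * r\<^sup>2) - r * \<rho>\<^sup>2 + \<rho>\<^sup>2 + 4 * (\<rho> * r\<^sup>2) + 3 * r - 1"
      by (simp add: theta_poly_def \<rho>_def power_add power_mult power2_eq_square
        power_mult_distrib mult_ac)
    ultimately show ?thesis using poly[folded r_def] by linarith
  qed
  define K where "K = r / (1 - \<rho>\<^sup>2)"
  have K: "0 \<le> K" "2 * K \<le> 1" using r \<rho>2 slope by (auto simp: K_def field_simps)
  have "r * d \<le> K * (1 - u\<^sup>2)"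
    using mult_left_mono[OF u(2) r(1)] \<rho>2 by (simp add: K_def field_simps)
  moreover have "u + K * (1 - u\<^sup>2) \<le> v + K * (1 - v\<^sup>2)"
  proof -
    have "K * (u + v) \<le> K * 2" using u v1 K by (intro mult_left_mono) auto
    then have "0 \<le> (v - u) * (1 - K * (u + v))"
      using u K by (intro mult_nonneg_nonneg) linarith+
    then show ?thesis by (simp add: algebra_simps power2_eq_square)
  qed
  moreover have "K * (1 - v\<^sup>2) = r * ((1 - a\<^sup>2) / (1 + a * \<rho>)\<^sup>2)"
    using \<rho>2 unfolding v_def one_minus_moebius_square[OF pos] by (simp add: K_def)
  moreover have "majorant_tail 2 f r + (1 + a * r) / ((1 + a) * (1 - r)) * sqnorm0 f r
           \<le> (1 - a\<^sup>2) * r\<^sup>2 / (1 - r)"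
    using refined_bohr[OF f r] by (simp add: a_def)
  moreover have "G_fun f \<omega> z = u + r * d + majorant_tail 2 f r
      + (1 + a * r) / ((1 + a) * (1 - r)) * sqnorm0 f r"
    by (simp add: G_fun_def Let_def u_def d_def r_def a_def)
  ultimately have "G_fun f \<omega> z \<le> 1 - (1 - a) * G_gap r \<rho> a"
    using G_bound_eq_gap[OF pos, of r] unfolding v_def by linarith
  moreover have "0 \<le> G_gap r \<rho> a"
  proof -
    have "0 \<le> G_gap r \<rho> 1"
      unfolding \<rho>_def G_gap_1[OF r]
      using poly[folded r_def] r by (intro divide_nonneg_nonneg mult_nonneg_nonneg) auto
    then have "0 \<le> (1 + a * \<rho>) * G_gap r \<rho> a"
      using G_gap_mono[OF r, of \<rho> a] \<rho> a by (auto intro: order_trans[rotated])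
    then show ?thesis using pos by (simp add: zero_le_mult_iff)
  qed
  ultimately show ?thesis
    using a mult_nonneg_nonneg[of "1 - a" "G_gap r \<rho> a"] by linarith
qed

lemma H_fun_le_1:
  assumes f: "f \<in> unit_bounded" and \<omega>: "\<omega> \<in> unit_bounded_ord m" and m: "m \<ge> 1"
    and z: "cmod z < 1" and poly: "vartheta_poly m (cmod z) \<le> 0"
  shows "H_fun f \<omega> z \<le> 1"
proof -
  define r \<rho> a where "r = cmod z" and "\<rho> = r ^ m" and "a = cmod (tcoeff f 0)"
  define u d v where "u = cmod (f (\<omega> z))" and "d = cmod (deriv f (\<omega> z))"
    and "v = (\<rho> + a) / (1 + a * \<rho>)"
  have r: "0 \<le> r" "r < 1" using z by (auto simp: r_def)
  have \<rho>: "0 \<le> \<rho>" "\<rho> < 1" using r m by (auto simp: \<rho>_def power_less_one_iff)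
  have \<rho>2: "\<rho>\<^sup>2 < 1" using \<rho> by (simp add: power_less_one_iff)
  have a: "0 \<le> a" "a \<le> 1" using cmod_tcoeff_0_le[OF f] by (auto simp: a_def)
  have pos: "1 + a * \<rho> > 0" using a \<rho> by (simp add: add_pos_nonneg)
  have u: "u \<le> v" "d * (1 - \<rho>\<^sup>2) \<le> 1 - u\<^sup>2" "0 \<le> u"
    using value_deriv_at_schwarz_function[OF f \<omega> m z]
    by (simp_all add: u_def v_def d_def a_def \<rho>_def r_def)
  \<comment> \<open>Ensures that \<open>u\<^sup>2 + K (1 - u\<^sup>2)\<close> increases with \<open>u\<close>.\<close>
  have slope: "r \<le> 1 - \<rho>\<^sup>2"
  proof -
    have "r * \<rho>\<^sup>2 \<le> r * 1" using r \<rho>2 by (intro mult_left_mono) auto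
    moreover have "0 \<le> \<rho>\<^sup>2 * r\<^sup>2" "0 \<le> \<rho> * r\<^sup>2" using \<rho> by simp_all
    moreover have "vartheta_poly m r = \<rho>\<^sup>2 * r\<^sup>2 - r * \<rho>\<^sup>2 + \<rho>\<^sup>2 + 2 * (\<rho> * r\<^sup>2) + 2 * r - 1"
      by (simp add: vartheta_poly_def \<rho>_def power_add power_mult power2_eq_square
        power_mult_distrib mult_ac)
    ultimately show ?thesis using poly[folded r_def] by linarith
  qed
  define K where "K = r / (1 - \<rho>\<^sup>2)"
  have K: "K \<le> 1" using \<rho>2 slope by (auto simp: K_def field_simps)
  have "r * d \<le> K * (1 - u\<^sup>2)"
    using mult_left_mono[OF u(2) r(1)] \<rho>2 by (simp add: K_def field_simps)
  moreover have "u\<^sup>2 + K * (1 - u\<^sup>2) \<le> v\<^sup>2 + K * (1 - v\<^sup>2)"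
  proof -
    have "u\<^sup>2 \<le> v\<^sup>2" using u by (intro power_mono)
    then have "0 \<le> (v\<^sup>2 - u\<^sup>2) * (1 - K)"
      using K by (intro mult_nonneg_nonneg) linarith+
    then show ?thesis by (simp add: algebra_simps)
  qed
  moreover have "K * (1 - v\<^sup>2) = r * ((1 - a\<^sup>2) / (1 + a * \<rho>)\<^sup>2)"
    using \<rho>2 unfolding v_def one_minus_moebius_square[OF pos] by (simp add: K_def)
  moreover have "majorant_tail 2 f r + (1 + a * r) / ((1 + a) * (1 - r)) * sqnorm0 f r
           \<le> (1 - a\<^sup>2) * r\<^sup>2 / (1 - r)"
    using refined_bohr[OF f r] by (simp add: a_def)
  moreover have "H_fun f \<omega> z = u\<^sup>2 + r * d + majorant_tail 2 f r
      + (1 + a * r) / ((1 + a) * (1 - r)) * sqnorm0 f r"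
    by (simp add: H_fun_def Let_def u_def d_def r_def a_def)
  ultimately have "H_fun f \<omega> z \<le> 1 - (1 - a\<^sup>2) * H_gap r \<rho> a"
    using H_bound_eq_gap[OF pos, of r] unfolding v_def by linarith
  moreover have "0 \<le> H_gap r \<rho> a"
  proof -
    have "0 \<le> H_gap r \<rho> 1"
      unfolding \<rho>_def H_gap_1[OF r]
      using poly[folded r_def] r by (intro divide_nonneg_nonneg mult_nonneg_nonneg) auto
    then show ?thesis
      using H_gap_mono[of \<rho> a r] \<rho> a slope by linarith
  qed
  moreover have "a\<^sup>2 \<le> 1" using a by (simp add: power_le_one)
  ultimately show ?thesis
    using mult_nonneg_nonneg[of "1 - a\<^sup>2" "H_gap r \<rho> a"] by linarith
qed

section \<open>Sharpness\<close>

lemma power_in_unit_bounded_ord: "(\<lambda>z. z ^ m) \<in> unit_bounded_ord m"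
proof -
  have "(\<lambda>z::complex. z ^ m) has_fps_expansion fps_X ^ m"
    by (rule has_fps_expansion_fps_X_power)
  then have "tcoeff (\<lambda>z. z ^ m) k = (if k = m then 1 else 0)" for k
    using has_fps_expansion_tcoeff by (fastforce simp: fps_X_power_nth)
  then have "(deriv ^^ k) (\<lambda>z::complex. z ^ m) 0 / fact k = (if k = m then 1 else 0)" for k
    by (simp only: tcoeff_eq_deriv)
  from this[THEN iffD1[OF divide_eq_eq]]
  have "(deriv ^^ k) (\<lambda>z::complex. z ^ m) 0 = (if k = m then fact m else 0)" for k
    by simp
  moreover have "(\<lambda>z::complex. z ^ m) \<in> unit_bounded"
    by (auto simp: unit_bounded_iff norm_power power_le_one intro!: holomorphic_intros)
  ultimately show ?thesis
    by (simp add: unit_bounded_ord_def)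
qed

text \<open>The extremal functions are \<open>z \<mapsto> (z + a) / (1 + a z)\<close>. With a plus sign, the value and the
  derivative at the positive point \<open>r\<^sup>m\<close> attain both Schwarz--Pick bounds.\<close>
definition moebius_map :: "real \<Rightarrow> complex \<Rightarrow> complex" where
  "moebius_map a = Moebius_function 0 (- of_real a)"

lemma moebius_map_eq: "moebius_map a = (\<lambda>z. (of_real a + z) / (1 + of_real a * z))"
  by (simp add: moebius_map_def Moebius_function_def add.commute)

context
  fixes a :: real
  assumes a: "0 < a" "a < 1"
begin

lemma moebius_map_denom_nz:
  assumes "cmod z < 1"
  shows "1 + of_real a * z \<noteq> 0"
  using norm_moebius_le_1(1)[of z "- of_real a"] a assms by simp

lemma moebius_map_unit_bounded: "moebius_map a \<in> unit_bounded"
  using a by (auto simp: unit_bounded_iff moebius_map_def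
      intro!: Moebius_function_holomorphic less_imp_le[OF Moebius_function_norm_lt_1])

lemma tcoeff_moebius_map:
  "tcoeff (moebius_map a) 0 = of_real a"
  "tcoeff (moebius_map a) (Suc n) = of_real (1 - a\<^sup>2) * of_real (- a) ^ n"
proof -
  define q where "q = complex_of_real (- a)"
  define c :: "nat \<Rightarrow> complex" where
    "c = (\<lambda>n. if n = 0 then of_real a else of_real (1 - a\<^sup>2) * q ^ (n - 1))"
  have sums: "(\<lambda>n. c n * u ^ n) sums moebius_map a u" if u: "cmod u < 1" for u
  proof -
    have "cmod (q * u) < 1 * 1"
      using a u unfolding norm_mult q_def by (intro mult_strict_mono) auto
    then have "(\<lambda>n. (q * u) ^ n) sums (1 / (1 - q * u))"
      by (intro geometric_sums) simp
    from sums_mult[OF this, of "of_real (1 - a\<^sup>2) * u"]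
    have "(\<lambda>n. c (Suc n) * u ^ Suc n) sums (of_real (1 - a\<^sup>2) * u / (1 - q * u))"
      by (simp add: c_def power_mult_distrib mult_ac)
    then have "(\<lambda>n. c (Suc n) * u ^ Suc n) sums (of_real (1 - a\<^sup>2) * u / (1 + of_real a * u))"
      by (simp add: q_def)
    then have "(\<lambda>n. c n * u ^ n) sums (of_real (1 - a\<^sup>2) * u / (1 + of_real a * u) + c 0 * u ^ 0)"
      by (rule sums_Suc)
    also have "of_real (1 - a\<^sup>2) * u / (1 + of_real a * u) + c 0 * u ^ 0 = moebius_map a u"
      using moebius_map_denom_nz[OF u]
      by (simp add: c_def moebius_map_eq field_simps power2_eq_square)
    finally show ?thesis .
  qed
  have "eventually (\<lambda>u. u \<in> ball 0 1) (nhds (0::complex))"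
    by (intro eventually_nhds_in_open) auto
  then have "moebius_map a has_fps_expansion Abs_fps c"
    by (intro has_fps_expansionI) (auto elim!: eventually_mono intro!: sums)
  then have "tcoeff (moebius_map a) n = c n" for n
    using has_fps_expansion_tcoeff by fastforce
  then show "tcoeff (moebius_map a) 0 = of_real a"
    "tcoeff (moebius_map a) (Suc n) = of_real (1 - a\<^sup>2) * of_real (- a) ^ n"
    by (simp_all add: c_def q_def)
qed

text \<open>Equality in \<open>refined_bohr\<close>.\<close>
lemma refined_bohr_moebius_map:
  assumes r: "0 \<le> r" "r < 1"
  shows "majorant_tail 2 (moebius_map a) r
          + (1 + a * r) / ((1 + a) * (1 - r)) * sqnorm0 (moebius_map a) r
       = (1 - a\<^sup>2) * r\<^sup>2 / (1 - r)"
proof -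
  have a2: "0 \<le> 1 - a\<^sup>2" using a by (simp add: power_le_one)
  have ar: "0 \<le> a * r" "a * r < 1"
    using a r mult_strict_mono[of a 1 r 1] by auto
  have norm_coeff: "cmod (tcoeff (moebius_map a) (Suc n)) = (1 - a\<^sup>2) * a ^ n" for n
    using a a2 unfolding tcoeff_moebius_map
    by (simp only: norm_mult norm_power norm_of_real) simp
  have "(\<lambda>n. (1 - a\<^sup>2) * a * r\<^sup>2 * (a * r) ^ n) sums ((1 - a\<^sup>2) * a * r\<^sup>2 * (1 / (1 - a * r)))"
    using ar by (intro sums_mult geometric_sums) simp
  moreover have "cmod (tcoeff (moebius_map a) (n + 2)) * r ^ (n + 2)
      = (1 - a\<^sup>2) * a * r\<^sup>2 * (a * r) ^ n" for n
    using norm_coeff[of "Suc n"] by (simp add: power_mult_distrib power2_eq_square mult_ac)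
  ultimately have maj: "majorant_tail 2 (moebius_map a) r = (1 - a\<^sup>2) * a * r\<^sup>2 / (1 - a * r)"
    unfolding majorant_tail_def by (simp add: sums_iff)
  have "(\<lambda>n. (1 - a\<^sup>2)\<^sup>2 * r\<^sup>2 * ((a * r)\<^sup>2) ^ n) sums ((1 - a\<^sup>2)\<^sup>2 * r\<^sup>2 * (1 / (1 - (a * r)\<^sup>2)))"
    using ar by (intro sums_mult geometric_sums) (simp add: abs_square_less_1)
  moreover have "(cmod (tcoeff (moebius_map a) (n + 1)))\<^sup>2 * r ^ (2 * (n + 1))
      = (1 - a\<^sup>2)\<^sup>2 * r\<^sup>2 * ((a * r)\<^sup>2) ^ n" for n
  proof -
    have "r ^ (2 * (n + 1)) = r\<^sup>2 * (r\<^sup>2) ^ n"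
      by (simp only: power_mult) simp
    moreover have "(a ^ n)\<^sup>2 = (a\<^sup>2) ^ n"
      by (simp add: mult.commute flip: power_mult)
    ultimately show ?thesis
      unfolding add_Suc_right add_0_right One_nat_def norm_coeff power_mult_distrib
      by (simp add: mult_ac)
  qed
  ultimately have sq: "sqnorm0 (moebius_map a) r = (1 - a\<^sup>2)\<^sup>2 * r\<^sup>2 / (1 - (a * r)\<^sup>2)"
    unfolding sqnorm0_def by (simp add: sums_iff)
  have nz: "1 - a * r \<noteq> 0" "1 + a * r \<noteq> 0" "1 + a \<noteq> 0" "1 - r \<noteq> 0"
    using a r ar by linarith+
  have e: "1 - (a * r)\<^sup>2 = (1 + a * r) * (1 - a * r)" "(1 - a\<^sup>2)\<^sup>2 = (1 - a\<^sup>2) * ((1 - a) * (1 + a))"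
    by (simp_all add: power2_eq_square algebra_simps)
  have "(1 + a * r) / ((1 + a) * (1 - r)) * sqnorm0 (moebius_map a) r
      = (1 - a\<^sup>2) * r\<^sup>2 / (1 - a * r) * ((1 - a) / (1 - r))"
    unfolding sq e using nz by (simp add: mult_ac)
  then have "majorant_tail 2 (moebius_map a) r
      + (1 + a * r) / ((1 + a) * (1 - r)) * sqnorm0 (moebius_map a) r
      = (1 - a\<^sup>2) * r\<^sup>2 / (1 - a * r) * (a + (1 - a) / (1 - r))"
    unfolding maj by (simp only: distrib_left) simp
  also have "a + (1 - a) / (1 - r) = (1 - a * r) / (1 - r)"
    using nz by (simp add: field_simps)
  finally show ?thesis
    using nz by simp
qed

lemma moebius_map_extremal:
  assumes r: "0 \<le> r" "r < 1" and m: "m \<ge> 1"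
  shows "G_fun (moebius_map a) (\<lambda>z. z ^ m) (of_real r) = 1 - (1 - a) * G_gap r (r ^ m) a"
    and "H_fun (moebius_map a) (\<lambda>z. z ^ m) (of_real r) = 1 - (1 - a\<^sup>2) * H_gap r (r ^ m) a"
proof -
  define \<rho> where "\<rho> = r ^ m"
  have \<rho>: "0 \<le> \<rho>" "\<rho> < 1" using r m by (auto simp: \<rho>_def power_less_one_iff)
  have pos: "1 + a * \<rho> > 0" using a \<rho> by (simp add: add_pos_nonneg)
  have a2: "0 \<le> 1 - a\<^sup>2" using a by (simp add: power_le_one)
  have "moebius_map a (of_real \<rho>) = of_real ((\<rho> + a) / (1 + a * \<rho>))"
    by (simp add: moebius_map_eq add.commute)
  then have val: "cmod (moebius_map a (of_real r ^ m)) = (\<rho> + a) / (1 + a * \<rho>)"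
    using a \<rho> pos unfolding \<rho>_def of_real_power[symmetric] by (simp only: norm_of_real) simp
  have "(moebius_map a has_field_derivative of_real (1 - a\<^sup>2) / (1 + of_real a * of_real \<rho>)\<^sup>2)
      (at (of_real \<rho>))"
    unfolding moebius_map_eq using moebius_map_denom_nz[of "of_real \<rho>"] \<rho>
    by (auto intro!: derivative_eq_intros simp: power2_eq_square algebra_simps)
  then have "deriv (moebius_map a) (of_real \<rho>) = of_real ((1 - a\<^sup>2) / (1 + a * \<rho>)\<^sup>2)"
    by (simp add: DERIV_imp_deriv)
  then have der: "cmod (deriv (moebius_map a) (of_real r ^ m)) = (1 - a\<^sup>2) / (1 + a * \<rho>)\<^sup>2"
    using a2 by (simp only: \<rho>_def of_real_power[symmetric] norm_of_real) simp
  have "G_fun (moebius_map a) (\<lambda>z. z ^ m) (of_real r)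
      = (\<rho> + a) / (1 + a * \<rho>) + r * ((1 - a\<^sup>2) / (1 + a * \<rho>)\<^sup>2) + (1 - a\<^sup>2) * r\<^sup>2 / (1 - r)"
    using refined_bohr_moebius_map[OF r] a r
    by (simp add: G_fun_def Let_def val der tcoeff_moebius_map)
  then show "G_fun (moebius_map a) (\<lambda>z. z ^ m) (of_real r) = 1 - (1 - a) * G_gap r (r ^ m) a"
    using G_bound_eq_gap[OF pos, of r] by (simp add: \<rho>_def)
  have "H_fun (moebius_map a) (\<lambda>z. z ^ m) (of_real r)
      = ((\<rho> + a) / (1 + a * \<rho>))\<^sup>2 + r * ((1 - a\<^sup>2) / (1 + a * \<rho>)\<^sup>2) + (1 - a\<^sup>2) * r\<^sup>2 / (1 - r)"
    using refined_bohr_moebius_map[OF r] a r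
    by (simp add: H_fun_def Let_def val der tcoeff_moebius_map)
  then show "H_fun (moebius_map a) (\<lambda>z. z ^ m) (of_real r) = 1 - (1 - a\<^sup>2) * H_gap r (r ^ m) a"
    using H_bound_eq_gap[OF pos, of r] by (simp add: \<rho>_def)
qed

end

lemma ex_negative_left_of_1:
  fixes g :: "real \<Rightarrow> real"
  assumes "isCont g 1" "g 1 < 0"
  obtains a where "0 < a" "a < 1" "g a < 0"
proof -
  have "(g \<longlongrightarrow> g 1) (at_left 1)"
    using assms(1) by (simp add: isCont_def filterlim_at_split)
  then have "eventually (\<lambda>a. g a < 0) (at_left 1)"
    using assms(2) by (rule order_tendstoD)
  moreover have "eventually (\<lambda>a::real. a \<in> {0<..<1}) (at_left 1)"
    by (rule eventually_at_left_real) simp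
  ultimately have "eventually (\<lambda>a. 0 < a \<and> a < 1 \<and> g a < 0) (at_left 1)"
    by eventually_elim auto
  then show thesis
    using that eventually_happens'[OF trivial_limit_at_left_real] by blast
qed

lemma G_fun_gt_1:
  assumes r: "0 < r" "r < 1" and m: "m \<ge> 1" and poly: "theta_poly m r > 0"
  shows "\<exists>f\<in>unit_bounded. \<exists>\<omega>\<in>unit_bounded_ord m. G_fun f \<omega> (of_real r) > 1"
proof -
  have "1 + r ^ m > 0" using r by (simp add: add_pos_nonneg)
  then have "isCont (G_gap r (r ^ m)) 1"
    unfolding G_gap_def using r by (intro continuous_intros) auto
  moreover have "G_gap r (r ^ m) 1 < 0"
  proof -
    have "0 < (1 + r ^ m)\<^sup>2 * (1 - r)"
      using r \<open>1 + r ^ m > 0\<close> by simp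
    then show ?thesis
      using r poly by (subst G_gap_1) (auto intro: divide_neg_pos simp del: divide_minus_left)
  qed
  ultimately obtain a where a: "0 < a" "a < 1" "G_gap r (r ^ m) a < 0"
    by (rule ex_negative_left_of_1)
  then have "(1 - a) * G_gap r (r ^ m) a < 0" by (simp add: mult_pos_neg)
  then have "G_fun (moebius_map a) (\<lambda>z. z ^ m) (of_real r) > 1"
    using moebius_map_extremal(1)[OF a(1,2), of r m] r m by simp
  then show ?thesis
    using moebius_map_unit_bounded[OF a(1,2)] power_in_unit_bounded_ord by blast
qed

lemma H_fun_gt_1:
  assumes r: "0 < r" "r < 1" and m: "m \<ge> 1" and poly: "vartheta_poly m r > 0"
  shows "\<exists>f\<in>unit_bounded. \<exists>\<omega>\<in>unit_bounded_ord m. H_fun f \<omega> (of_real r) > 1"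
proof -
  have "1 + r ^ m > 0" using r by (simp add: add_pos_nonneg)
  then have "isCont (H_gap r (r ^ m)) 1"
    unfolding H_gap_def using r by (intro continuous_intros) auto
  moreover have "H_gap r (r ^ m) 1 < 0"
  proof -
    have "0 < (1 + r ^ m)\<^sup>2 * (1 - r)"
      using r \<open>1 + r ^ m > 0\<close> by simp
    then show ?thesis
      using r poly by (subst H_gap_1) (auto intro: divide_neg_pos simp del: divide_minus_left)
  qed
  ultimately obtain a where a: "0 < a" "a < 1" "H_gap r (r ^ m) a < 0"
    by (rule ex_negative_left_of_1)
  have "a\<^sup>2 < 1" using a by (simp add: power_less_one_iff)
  then have "(1 - a\<^sup>2) * H_gap r (r ^ m) a < 0" using a(3) by (simp add: mult_pos_neg)
  then have "H_fun (moebius_map a) (\<lambda>z. z ^ m) (of_real r) > 1"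
    using moebius_map_extremal(2)[OF a(1,2), of r m] r m by simp
  then show ?thesis
    using moebius_map_unit_bounded[OF a(1,2)] power_in_unit_bounded_ord by blast
qed

section \<open>The sharp radii\<close>

theorem theorem4:
  fixes m :: nat
  assumes "m \<ge> 1"
  shows
    "((\<exists>!\<theta>. \<theta> \<in> {0<..<1} \<and> theta_poly m \<theta> = 0) \<and>
      (\<forall>\<theta>\<in>{0<..<1}. theta_poly m \<theta> = 0 \<longrightarrow>
         (\<forall>f\<in>unit_bounded. \<forall>\<omega>\<in>unit_bounded_ord m. \<forall>z. cmod z \<le> \<theta> \<longrightarrow> G_fun f \<omega> z \<le> 1) \<and>
         \<not> (\<exists>\<rho>\<in>{\<theta><..<1}. \<forall>f\<in>unit_bounded. \<forall>\<omega>\<in>unit_bounded_ord m. \<forall>z.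
               cmod z \<le> \<rho> \<longrightarrow> G_fun f \<omega> z \<le> 1))) \<and>
     ((\<exists>!\<theta>. \<theta> \<in> {0<..<1} \<and> vartheta_poly m \<theta> = 0) \<and>
      (\<forall>\<theta>\<in>{0<..<1}. vartheta_poly m \<theta> = 0 \<longrightarrow>
         (\<forall>f\<in>unit_bounded. \<forall>\<omega>\<in>unit_bounded_ord m. \<forall>z. cmod z \<le> \<theta> \<longrightarrow> H_fun f \<omega> z \<le> 1) \<and>
         \<not> (\<exists>\<rho>\<in>{\<theta><..<1}. \<forall>f\<in>unit_bounded. \<forall>\<omega>\<in>unit_bounded_ord m. \<forall>z.
               cmod z \<le> \<rho> \<longrightarrow> H_fun f \<omega> z \<le> 1)))"
proof (intro conjI ballI impI)
  show "\<exists>!\<theta>. \<theta> \<in> {0<..<1} \<and> theta_poly m \<theta> = 0"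
    using assms by (intro ex1_root_unit_interval theta_poly_strict_mono)
      (auto simp: theta_poly_def power_0_left intro!: continuous_intros)
next
  fix \<theta> :: real
  assume \<theta>: "\<theta> \<in> {0<..<1}" "theta_poly m \<theta> = 0"
  show "\<forall>z. cmod z \<le> \<theta> \<longrightarrow> G_fun f \<omega> z \<le> 1"
    if "f \<in> unit_bounded" "\<omega> \<in> unit_bounded_ord m" for f \<omega>
  proof (intro allI impI)
    fix z :: complex assume z: "cmod z \<le> \<theta>"
    then have "theta_poly m (cmod z) \<le> 0"
      using theta_poly_strict_mono[of "cmod z" \<theta> m] \<theta> by (cases "cmod z = \<theta>") auto
    then show "G_fun f \<omega> z \<le> 1"
      using G_fun_le_1[OF that assms] z \<theta> by simp
  qed
  show "\<not> (\<exists>\<rho>\<in>{\<theta><..<1}. \<forall>f\<in>unit_bounded. \<forall>\<omega>\<in>unit_bounded_ord m. \<forall>z.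
               cmod z \<le> \<rho> \<longrightarrow> G_fun f \<omega> z \<le> 1)"
  proof
    assume "\<exists>\<rho>\<in>{\<theta><..<1}. \<forall>f\<in>unit_bounded. \<forall>\<omega>\<in>unit_bounded_ord m. \<forall>z.
               cmod z \<le> \<rho> \<longrightarrow> G_fun f \<omega> z \<le> 1"
    then obtain \<rho> where \<rho>: "\<theta> < \<rho>" "\<rho> < 1" and
      le: "\<And>f \<omega> z. f \<in> unit_bounded \<Longrightarrow> \<omega> \<in> unit_bounded_ord m \<Longrightarrow> cmod z \<le> \<rho> \<Longrightarrow> G_fun f \<omega> z \<le> 1"
      by auto
    have "theta_poly m \<rho> > 0"
      using theta_poly_strict_mono[of \<theta> \<rho> m] \<theta> \<rho> by simp
    then obtain f \<omega> where "f \<in> unit_bounded" "\<omega> \<in> unit_bounded_ord m" "G_fun f \<omega> (of_real \<rho>) > 1"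
      using G_fun_gt_1[of \<rho> m] \<theta> \<rho> assms by auto
    with le[of f \<omega> "of_real \<rho>"] \<theta> \<rho> show False by simp
  qed
next
  show "\<exists>!\<theta>. \<theta> \<in> {0<..<1} \<and> vartheta_poly m \<theta> = 0"
    using assms by (intro ex1_root_unit_interval vartheta_poly_strict_mono)
      (auto simp: vartheta_poly_def power_0_left intro!: continuous_intros)
next
  fix \<theta> :: real
  assume \<theta>: "\<theta> \<in> {0<..<1}" "vartheta_poly m \<theta> = 0"
  show "\<forall>z. cmod z \<le> \<theta> \<longrightarrow> H_fun f \<omega> z \<le> 1"
    if "f \<in> unit_bounded" "\<omega> \<in> unit_bounded_ord m" for f \<omega>
  proof (intro allI impI)
    fix z :: complex assume z: "cmod z \<le> \<theta>"
    then have "vartheta_poly m (cmod z) \<le> 0"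
      using vartheta_poly_strict_mono[of "cmod z" \<theta> m] \<theta> by (cases "cmod z = \<theta>") auto
    then show "H_fun f \<omega> z \<le> 1"
      using H_fun_le_1[OF that assms] z \<theta> by simp
  qed
  show "\<not> (\<exists>\<rho>\<in>{\<theta><..<1}. \<forall>f\<in>unit_bounded. \<forall>\<omega>\<in>unit_bounded_ord m. \<forall>z.
               cmod z \<le> \<rho> \<longrightarrow> H_fun f \<omega> z \<le> 1)"
  proof
    assume "\<exists>\<rho>\<in>{\<theta><..<1}. \<forall>f\<in>unit_bounded. \<forall>\<omega>\<in>unit_bounded_ord m. \<forall>z.
               cmod z \<le> \<rho> \<longrightarrow> H_fun f \<omega> z \<le> 1"
    then obtain \<rho> where \<rho>: "\<theta> < \<rho>" "\<rho> < 1" and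
      le: "\<And>f \<omega> z. f \<in> unit_bounded \<Longrightarrow> \<omega> \<in> unit_bounded_ord m \<Longrightarrow> cmod z \<le> \<rho> \<Longrightarrow> H_fun f \<omega> z \<le> 1"
      by auto
    have "vartheta_poly m \<rho> > 0"
      using vartheta_poly_strict_mono[of \<theta> \<rho> m] \<theta> \<rho> by simp
    then obtain f \<omega> where "f \<in> unit_bounded" "\<omega> \<in> unit_bounded_ord m" "H_fun f \<omega> (of_real \<rho>) > 1"
      using H_fun_gt_1[of \<rho> m] \<theta> \<rho> assms by auto
    with le[of f \<omega> "of_real \<rho>"] \<theta> \<rho> show False by simp
  qed
qed

end
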